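(* Let $q\in\mathbb{R}$, $q\neq -1$, and let $\{\omega_n\}_{n=1}^\infty$ be the Jacobi sequence of the $q$-Gaussian, i.e. $\omega_n = 1+q+q^2+\cdots+q^{n-1}$ if $q>-1$, and $\omega_n = (-1)^{n-1}\dfrac{q^n-1}{q-1}$ if $q<-1$. Then the moment problem for the $q$-Gaussian is indeterminate (that is, there is more than one probability measure on $\mathbb{R}$ corresponding to the Jacobi sequence $\{\omega_n\}_{n=1}^\infty$) if and only if $|q|>1$.
   Context: A (Borel) probability measure $\mu$ on $\mathbb{R}$ with infinite support and finite moments $M_n=\int_{\mathbb{R}}x^n\,d\mu$ of all orders corresponds to (realizes) the Jacobi sequence $\{\omega_n\}_{n=1}^\infty$, $\omega_n>0$, if its monic orthogonal polynomials $P_0=1,P_1,P_2,\dots$ satisfy $xP_n(x)=P_{n+1}(x)+\omega_nP_{n-1}(x)$ for all $n\ge 0$, with the convention $P_{-1}=0$. Jacobi sequences with all $\omega_n>0$ are in bijective correspondence with moment sequences of symmetric probability measures with infinite support, so the Jacobi sequence and the moment sequence carry the same data. The moment problem is determinate if there is exactly one probability measure on $\mathbb{R}$ with the given moment sequence, and indeterminate otherwise. *)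

theory Defs
  imports "HOL-Probability.Probability" "HOL-Computational_Algebra.Polynomial"
begin

definition measure_support :: "real measure \<Rightarrow> real set" where
  "measure_support \<mu> = {x. \<forall>U. open U \<longrightarrow> x \<in> U \<longrightarrow> emeasure \<mu> U > 0}"

definition borel_prob_measure :: "real measure \<Rightarrow> bool" where
  "borel_prob_measure \<mu> \<longleftrightarrow> prob_space \<mu> \<and> sets \<mu> = sets borel"

definition finite_moments :: "real measure \<Rightarrow> bool" where
  "finite_moments \<mu> \<longleftrightarrow> (\<forall>n::nat. integrable \<mu> (\<lambda>x. x ^ n))"

(* Meaningful for measures with finite moments; in the presence of infinite
   support there is exactly one such sequence P. *)
definition monic_orthogonal_polys :: "real measure \<Rightarrow> (nat \<Rightarrow> real poly) \<Rightarrow> bool" where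
  "monic_orthogonal_polys \<mu> P \<longleftrightarrow>
     (\<forall>n. degree (P n) = n \<and> lead_coeff (P n) = 1) \<and>
     (\<forall>m n. m \<noteq> n \<longrightarrow> (\<integral>x. poly (P m) x * poly (P n) x \<partial>\<mu>) = 0)"

(* Jacobi sequences are indexed from 1: the value \<omega> 0 is never used. The case n = 0
   of the recurrence encodes the convention P_{-1} = 0. *)
definition realizes_jacobi :: "real measure \<Rightarrow> (nat \<Rightarrow> real) \<Rightarrow> bool" where
  "realizes_jacobi \<mu> \<omega> \<longleftrightarrow>
     borel_prob_measure \<mu> \<and> infinite (measure_support \<mu>) \<and> finite_moments \<mu> \<and>
     (\<forall>n\<ge>1. \<omega> n > 0) \<and>
     (\<exists>P. monic_orthogonal_polys \<mu> P \<and>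
        (\<forall>n. [:0, 1:] * P n = P (Suc n) + (if n = 0 then 0 else smult (\<omega> n) (P (n - 1)))))"

definition indeterminate :: "(nat \<Rightarrow> real) \<Rightarrow> bool" where
  "indeterminate \<omega> \<longleftrightarrow>
     (\<exists>\<mu> \<nu>. realizes_jacobi \<mu> \<omega> \<and> realizes_jacobi \<nu> \<omega> \<and> \<mu> \<noteq> \<nu>)"

(* Meant for q \<noteq> -1 and n \<ge> 1 only. *)
definition q_gaussian_jacobi :: "real \<Rightarrow> nat \<Rightarrow> real" where
  "q_gaussian_jacobi q n =
     (if q > -1 then (\<Sum>k<n. q ^ k) else (-1) ^ (n - 1) * ((q ^ n - 1) / (q - 1)))"

end

theory Submission
  imports Defs "HOL-Computational_Algebra.Fundamental_Theorem_Algebra"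
begin

text \<open>
  Let \<open>P\<^sub>n\<close> be the monic polynomials given by the recurrence with Jacobi sequence \<open>\<omega>\<close>, and let \<open>h\<^sub>n\<close> be the
  product of \<open>\<omega> 1, \<dots>, \<omega> n\<close>, which is the squared norm of \<open>P\<^sub>n\<close>. A probability measure realizes a
  positive \<open>\<omega>\<close> exactly when its moments are certain numbers computed from \<open>\<omega>\<close>
  (\<open>realizes_jacobi_of_moments\<close> and \<open>moments_of_realizes_jacobi\<close>), so the question is whether these
  moments determine the measure.

  If \<open>\<bar>q\<bar> \<le> 1\<close> then \<open>\<omega> n \<le> n\<close>. Moments are monotone in \<open>\<omega>\<close>, so they are at most those of the standard normal
  distribution, which has \<open>\<omega> n = n\<close>. This is slow enough for the characteristic function to be the sum of
  its Taylor series, and the measure is unique (\<open>not_indeterminate_of_linear_bound\<close>).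

  If \<open>\<bar>q\<bar> > 1\<close> then \<open>\<omega> n\<close> grows like \<open>\<bar>q\<bar>\<^sup>n\<close>. The recurrence then forces \<open>P\<^sub>n(a)\<^sup>2 / h\<^sub>n\<close> to decay geometrically
  at every real \<open>a\<close>; let \<open>\<kappa>(a)\<close> be the sum over \<open>n\<close>. If \<open>a\<close> is a zero of no \<open>P\<^sub>N\<close>, which
  excludes only countably many points, then for every \<open>N\<close> there is a quadrature formula, exact up to degree
  \<open>2 N\<close>, with a node at \<open>a\<close> whose weight is the reciprocal of the partial sum up to \<open>N\<close>
  (\<open>jacobi_quadrature_with_node\<close>). Helly's selection theorem yields a limit of the quadrature measures.
  It has the right moments and an atom of mass at least \<open>1 / \<kappa>(a)\<close> at \<open>a\<close>
  (\<open>realizing_measure_with_atom\<close>). If there were only one realizing measure, it would have an atom at every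
  real \<open>a\<close> outside a countable set. That is impossible, so the measure is not unique
  (\<open>indeterminate_of_geometric_growth\<close>).
\<close>

section \<open>Orthogonal polynomials of a Jacobi sequence\<close>

fun jacobi_poly :: "(nat \<Rightarrow> real) \<Rightarrow> nat \<Rightarrow> real poly" where
  "jacobi_poly \<omega> 0 = 1"
| "jacobi_poly \<omega> (Suc 0) = [:0, 1:]"
| "jacobi_poly \<omega> (Suc (Suc n)) =
     [:0, 1:] * jacobi_poly \<omega> (Suc n) - smult (\<omega> (Suc n)) (jacobi_poly \<omega> n)"

lemma jacobi_poly_recurrence:
  "[:0, 1:] * jacobi_poly \<omega> n =
     jacobi_poly \<omega> (Suc n) + (if n = 0 then 0 else smult (\<omega> n) (jacobi_poly \<omega> (n - 1)))"
  by (cases n) simp_all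

lemma jacobi_poly_unique:
  assumes "P 0 = 1"
    and "\<And>n. [:0, 1:] * P n = P (Suc n) + (if n = 0 then 0 else smult (\<omega> n) (P (n - 1)))"
  shows "P n = jacobi_poly \<omega> n"
proof (induction \<omega>\<equiv>\<omega> n rule: jacobi_poly.induct)
  case 1
  then show ?case using assms(1) by simp
next
  case 2
  then show ?case using assms(2)[of 0] assms(1) by simp
next
  case (3 n)
  then show ?case using assms(2)[of "Suc n"] by (simp add: algebra_simps)
qed

lemma degree_coeff_jacobi_poly:
  "degree (jacobi_poly \<omega> n) = n \<and> coeff (jacobi_poly \<omega> n) n = 1"
proof (induction \<omega> n rule: jacobi_poly.induct)
  case (3 \<omega> n)
  have deg: "degree ([:0, 1:] * jacobi_poly \<omega> (Suc n)) = Suc (Suc n)"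
    using 3 by (subst degree_mult_eq) auto
  have "degree (smult (\<omega> (Suc n)) (jacobi_poly \<omega> n)) < Suc (Suc n)"
    using 3 degree_smult_le[of "\<omega> (Suc n)" "jacobi_poly \<omega> n"] by linarith
  then have "degree (jacobi_poly \<omega> (Suc (Suc n))) = Suc (Suc n)"
    using deg by (simp add: degree_add_eq_left diff_conv_add_uminus
        del: mult_pCons_left add_uminus_conv_diff)
  moreover have "coeff (jacobi_poly \<omega> n) (Suc (Suc n)) = 0"
    using 3 by (intro coeff_eq_0) auto
  ultimately show ?case using 3 by simp
qed auto

lemmas degree_jacobi_poly [simp] = degree_coeff_jacobi_poly[THEN conjunct1]
lemmas lead_coeff_jacobi_poly [simp] = degree_coeff_jacobi_poly[THEN conjunct2]

lemma jacobi_poly_nonzero [simp]: "jacobi_poly \<omega> n \<noteq> 0"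
  using lead_coeff_jacobi_poly[of \<omega> n] by fastforce

text \<open>
  Each \<open>P\<^sub>k\<close> is monic of degree \<open>k\<close>, so every polynomial arises from \<open>0\<close> by adding multiples of the
  \<open>P\<^sub>k\<close> in increasing order of \<open>k\<close>. Degree below \<open>k\<close> is expressed by vanishing coefficients, which makes
  the zero polynomial an ordinary case.
\<close>
lemma jacobi_basis_induct [consumes 1, case_names zero step]:
  fixes p :: "real poly"
  assumes "\<forall>i\<ge>n. coeff p i = 0"
    and "Q 0"
    and step: "\<And>k a r. k < n \<Longrightarrow> \<forall>i\<ge>k. coeff r i = 0 \<Longrightarrow> Q r
           \<Longrightarrow> Q (smult a (jacobi_poly \<omega> k) + r)"
  shows "Q p"
  using assms(1) step
proof (induction n arbitrary: p)
  case 0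
  then have "p = 0" by (intro poly_eqI) auto
  then show ?case using assms(2) by simp
next
  case (Suc n)
  define r where "r = p - smult (coeff p n) (jacobi_poly \<omega> n)"
  have r: "coeff r i = 0" if "n \<le> i" for i
  proof (cases "i = n")
    case False
    then have "coeff (jacobi_poly \<omega> n) i = 0" using that by (intro coeff_eq_0) auto
    then show ?thesis using Suc.prems(1) that False by (simp add: r_def)
  qed (simp add: r_def)
  have "Q r"
  proof (rule Suc.IH)
    show "Q (smult a (jacobi_poly \<omega> k) + s)"
      if "k < n" "\<forall>i\<ge>k. coeff s i = 0" "Q s" for k a s
      by (rule Suc.prems(2)) (use that in simp_all)
  qed (simp add: r)
  with r have "Q (smult (coeff p n) (jacobi_poly \<omega> n) + r)"
    by (intro Suc.prems(2)) simp_all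
  then show ?case by (simp add: r_def)
qed

text \<open>
  The coefficient of \<open>P\<^sub>k\<close> in the expansion of \<open>x\<^sup>n\<close>: the recurrence below is what multiplication by \<open>x\<close>
  does to such an expansion. It is also the total weight of the nonnegative lattice paths with \<open>n\<close> steps
  up or down from height \<open>0\<close> to height \<open>k\<close>, where a step down from \<open>j\<close> to \<open>j - 1\<close> has weight \<open>\<omega> j\<close>. For
  \<open>k = 0\<close> these are the moments that belong to the Jacobi sequence.
\<close>
fun dyck_weight :: "(nat \<Rightarrow> real) \<Rightarrow> nat \<Rightarrow> nat \<Rightarrow> real" where
  "dyck_weight \<omega> 0 k = (if k = 0 then 1 else 0)"
| "dyck_weight \<omega> (Suc n) k =
     (if k = 0 then 0 else dyck_weight \<omega> n (k - 1)) + \<omega> (Suc k) * dyck_weight \<omega> n (Suc k)"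

lemma dyck_weight_eq_0: "n < k \<Longrightarrow> dyck_weight \<omega> n k = 0"
  by (induction n arbitrary: k) auto

lemma dyck_weight_diag [simp]: "dyck_weight \<omega> n n = 1"
  by (induction n) (auto simp: dyck_weight_eq_0)

definition moment_functional :: "(nat \<Rightarrow> real) \<Rightarrow> real poly \<Rightarrow> real" where
  "moment_functional m p = (\<Sum>i\<le>degree p. coeff p i * m i)"

lemma moment_functional_eq:
  assumes "degree p \<le> n"
  shows "moment_functional m p = (\<Sum>i\<le>n. coeff p i * m i)"
  unfolding moment_functional_def using assms
  by (intro sum.mono_neutral_left) (auto simp: coeff_eq_0)

lemma moment_functional_0 [simp]: "moment_functional m 0 = 0"
  by (simp add: moment_functional_def)

lemma moment_functional_add:
  "moment_functional m (p + q) = moment_functional m p + moment_functional m q"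
proof -
  let ?n = "max (degree p) (degree q)"
  have "degree (p + q) \<le> ?n" by (rule degree_add_le) auto
  then show ?thesis
    by (simp add: moment_functional_eq[of _ ?n] sum.distrib ring_distribs)
qed

lemma moment_functional_smult:
  "moment_functional m (smult a p) = a * moment_functional m p"
  by (simp add: moment_functional_eq[of "smult a p" "degree p"] degree_smult_le
      moment_functional_def sum_distrib_left mult.assoc)

lemma moment_functional_diff:
  "moment_functional m (p - q) = moment_functional m p - moment_functional m q"
  using moment_functional_add[of m p "smult (-1) q"] moment_functional_smult[of m "-1" q]
  by simp

lemma moment_functional_sum:
  "moment_functional m (\<Sum>x\<in>A. f x) = (\<Sum>x\<in>A. moment_functional m (f x))"
  by (induction A rule: infinite_finite_induct) (auto simp: moment_functional_add)

lemma moment_functional_monom [simp]: "moment_functional m (monom 1 n) = m n"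
proof -
  have "moment_functional m (monom 1 n) = (\<Sum>i\<le>n. coeff (monom 1 n) i * m i)"
    by (rule moment_functional_eq) (simp add: degree_monom_le)
  also have "\<dots> = (\<Sum>i\<in>{n}. coeff (monom 1 n) i * m i)"
    by (rule sum.mono_neutral_right) auto
  finally show ?thesis by simp
qed

text \<open>
  The expectation of a polynomial under any measure that realizes \<open>\<omega>\<close>. Its values on monomials are
  written down first; that the \<open>P\<^sub>n\<close> are orthogonal for it is proved below.
\<close>
abbreviation jacobi_functional :: "(nat \<Rightarrow> real) \<Rightarrow> real poly \<Rightarrow> real" where
  "jacobi_functional \<omega> \<equiv> moment_functional (\<lambda>n. dyck_weight \<omega> n 0)"

definition jacobi_norm :: "(nat \<Rightarrow> real) \<Rightarrow> nat \<Rightarrow> real" where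
  "jacobi_norm \<omega> n = (\<Prod>k=1..n. \<omega> k)"

lemma jacobi_norm_0 [simp]: "jacobi_norm \<omega> 0 = 1"
  by (simp add: jacobi_norm_def)

lemma jacobi_norm_Suc: "jacobi_norm \<omega> (Suc n) = \<omega> (Suc n) * jacobi_norm \<omega> n"
  by (simp add: jacobi_norm_def)

text \<open>
  The recurrence of the \<open>P\<^sub>k\<close> trades a higher index \<open>k\<close> for a higher power of \<open>x\<close>, and this is exactly the
  recurrence of the path weights. All orthogonality relations follow from this formula, because a path
  with \<open>n\<close> steps cannot rise above height \<open>n\<close>.
\<close>
lemma jacobi_functional_monom_mult:
  "jacobi_functional \<omega> (monom 1 n * jacobi_poly \<omega> k) = jacobi_norm \<omega> k * dyck_weight \<omega> n k"
proof (induction \<omega> k arbitrary: n rule: jacobi_poly.induct)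
  case (1 \<omega>)
  then show ?case by simp
next
  case (2 \<omega>)
  have "monom 1 n * jacobi_poly \<omega> (Suc 0) = monom 1 (Suc n)"
    by (simp add: monom_Suc)
  then show ?case by (simp add: jacobi_norm_Suc)
next
  case (3 \<omega> k)
  have "monom 1 n * jacobi_poly \<omega> (Suc (Suc k))
      = monom 1 (Suc n) * jacobi_poly \<omega> (Suc k) - smult (\<omega> (Suc k)) (monom 1 n * jacobi_poly \<omega> k)"
    by (simp add: monom_Suc algebra_simps)
  then have "jacobi_functional \<omega> (monom 1 n * jacobi_poly \<omega> (Suc (Suc k)))
      = jacobi_functional \<omega> (monom 1 (Suc n) * jacobi_poly \<omega> (Suc k))
        - \<omega> (Suc k) * jacobi_functional \<omega> (monom 1 n * jacobi_poly \<omega> k)"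
    by (simp only: moment_functional_diff moment_functional_smult)
  also have "\<dots> = jacobi_norm \<omega> (Suc (Suc k)) * dyck_weight \<omega> n (Suc (Suc k))"
    unfolding 3 by (simp add: jacobi_norm_Suc algebra_simps)
  finally show ?case .
qed

lemma jacobi_functional_mult:
  "jacobi_functional \<omega> (p * jacobi_poly \<omega> k)
     = jacobi_norm \<omega> k * (\<Sum>i\<le>degree p. coeff p i * dyck_weight \<omega> i k)"
proof -
  have "p * jacobi_poly \<omega> k = (\<Sum>i\<le>degree p. smult (coeff p i) (monom 1 i * jacobi_poly \<omega> k))"
    by (subst (1) poly_as_sum_of_monoms[symmetric])
       (simp add: sum_distrib_right smult_monom flip: mult_smult_left)
  then show ?thesis
    by (simp add: moment_functional_sum moment_functional_smult jacobi_functional_monom_mult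
        sum_distrib_left mult.left_commute)
qed

lemma jacobi_functional_lower:
  assumes "\<forall>i\<ge>k. coeff p i = 0"
  shows "jacobi_functional \<omega> (p * jacobi_poly \<omega> k) = 0"
proof -
  have "coeff p i * dyck_weight \<omega> i k = 0" for i
    using assms dyck_weight_eq_0[of i k \<omega>] by (cases "k \<le> i") auto
  then have "(\<Sum>i\<le>degree p. coeff p i * dyck_weight \<omega> i k) = 0"
    by (intro sum.neutral) blast
  then show ?thesis by (simp add: jacobi_functional_mult)
qed

lemma jacobi_functional_square:
  "jacobi_functional \<omega> (jacobi_poly \<omega> k * jacobi_poly \<omega> k) = jacobi_norm \<omega> k"
proof -
  have "(\<Sum>i\<le>k. coeff (jacobi_poly \<omega> k) i * dyck_weight \<omega> i k)
      = (\<Sum>i\<in>{k}. coeff (jacobi_poly \<omega> k) i * dyck_weight \<omega> i k)"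
    by (rule sum.mono_neutral_right) (auto simp: dyck_weight_eq_0)
  then show ?thesis by (simp add: jacobi_functional_mult)
qed

lemma jacobi_functional_orthogonal:
  "jacobi_functional \<omega> (jacobi_poly \<omega> j * jacobi_poly \<omega> k) = (if j = k then jacobi_norm \<omega> k else 0)"
proof -
  have *: "jacobi_functional \<omega> (jacobi_poly \<omega> j * jacobi_poly \<omega> k) = 0" if "j < k" for j k
    using that by (intro jacobi_functional_lower) (auto intro: coeff_eq_0)
  show ?thesis
    using *[of j k] *[of k j] jacobi_functional_square[of \<omega> k]
    by (cases j k rule: linorder_cases) (auto simp: mult.commute)
qed

lemma jacobi_norm_pos:
  assumes "\<forall>n\<ge>1. \<omega> n > 0"
  shows "jacobi_norm \<omega> n > 0"
  unfolding jacobi_norm_def using assms by (intro prod_pos) auto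

text \<open>
  Expanding \<open>p\<close> in the \<open>P\<^sub>k\<close> turns the value on \<open>p * p\<close> into a sum of squares with the positive weights
  \<open>jacobi_norm \<omega> k\<close>; the induction splits off the top term, which is orthogonal to the rest.
\<close>
lemma jacobi_functional_positive:
  assumes \<omega>: "\<forall>n\<ge>1. \<omega> n > 0" and "p \<noteq> 0"
  shows "jacobi_functional \<omega> (p * p) > 0"
proof -
  have "\<forall>i\<ge>Suc (degree p). coeff p i = 0"
    by (simp add: coeff_eq_0)
  then have "jacobi_functional \<omega> (p * p) \<ge> 0 \<and> (p \<noteq> 0 \<longrightarrow> jacobi_functional \<omega> (p * p) > 0)"
  proof (induction p rule: jacobi_basis_induct[where \<omega> = \<omega>])
    case zero
    then show ?case by simp
  next
    case (step k a r)
    let ?P = "jacobi_poly \<omega> k"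
    have "jacobi_functional \<omega> (r * ?P) = 0"
      using step(2) by (rule jacobi_functional_lower)
    moreover have "(smult a ?P + r) * (smult a ?P + r)
        = smult (a * a) (?P * ?P) + (smult (2 * a) (r * ?P) + r * r)"
    proof -
      have "smult (2 * a) (r * ?P) = smult a (r * ?P) + smult a (r * ?P)"
        by (simp flip: smult_add_left)
      then show ?thesis by (simp add: algebra_simps)
    qed
    ultimately have eq: "jacobi_functional \<omega> ((smult a ?P + r) * (smult a ?P + r))
        = a * a * jacobi_norm \<omega> k + jacobi_functional \<omega> (r * r)"
      by (simp only: moment_functional_add moment_functional_smult jacobi_functional_square)
    have pos: "jacobi_norm \<omega> k > 0" using \<omega> by (rule jacobi_norm_pos)
    have nn: "a * a * jacobi_norm \<omega> k \<ge> 0"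
      using mult_nonneg_nonneg[OF zero_le_square less_imp_le[OF pos]] .
    show ?case
    proof (cases "a = 0")
      case False
      then have "a * a * jacobi_norm \<omega> k > 0"
        using pos mult_pos_pos not_real_square_gt_zero by blast
      then show ?thesis using eq step(3) by auto
    qed (use step(3) in simp)
  qed
  then show ?thesis using \<open>p \<noteq> 0\<close> by blast
qed

text \<open>
  The Christoffel-Darboux kernel with one of its two variables fixed at \<open>x\<close>.
\<close>
definition kernel_poly :: "(nat \<Rightarrow> real) \<Rightarrow> real \<Rightarrow> nat \<Rightarrow> real poly" where
  "kernel_poly \<omega> x N = (\<Sum>k\<le>N. smult (poly (jacobi_poly \<omega> k) x / jacobi_norm \<omega> k) (jacobi_poly \<omega> k))"

lemma poly_kernel_poly_self:
  "poly (kernel_poly \<omega> x N) x = (\<Sum>k\<le>N. (poly (jacobi_poly \<omega> k) x)\<^sup>2 / jacobi_norm \<omega> k)"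
  by (simp add: kernel_poly_def poly_sum power2_eq_square)

text \<open>
  The reproducing property: by orthogonality both sides agree on each \<open>P\<^sub>k\<close> with \<open>k \<le> N\<close>.
\<close>
lemma jacobi_functional_kernel_poly:
  assumes \<omega>: "\<forall>n\<ge>1. \<omega> n > 0" and "degree p \<le> N"
  shows "jacobi_functional \<omega> (p * kernel_poly \<omega> x N) = poly p x"
proof -
  have "\<forall>i\<ge>Suc N. coeff p i = 0"
    using assms(2) by (simp add: coeff_eq_0)
  then show ?thesis
  proof (induction p rule: jacobi_basis_induct[where \<omega> = \<omega>])
    case (step k a r)
    have "jacobi_norm \<omega> k \<noteq> 0" using jacobi_norm_pos[OF \<omega>, of k] by simp
    have "jacobi_functional \<omega> (jacobi_poly \<omega> k * kernel_poly \<omega> x N)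
        = (\<Sum>j\<le>N. poly (jacobi_poly \<omega> j) x / jacobi_norm \<omega> j * (if k = j then jacobi_norm \<omega> j else 0))"
      by (simp add: kernel_poly_def sum_distrib_left moment_functional_sum
          moment_functional_smult jacobi_functional_orthogonal)
    also have "\<dots> = (\<Sum>j\<in>{k}. poly (jacobi_poly \<omega> j) x / jacobi_norm \<omega> j * (if k = j then jacobi_norm \<omega> j else 0))"
      using step(1) by (intro sum.mono_neutral_right) auto
    also have "\<dots> = poly (jacobi_poly \<omega> k) x"
      using \<open>jacobi_norm \<omega> k \<noteq> 0\<close> by simp
    finally show ?case using step(3)
      by (simp add: distrib_right moment_functional_add moment_functional_smult)
  qed simp
qed

lemma degree_kernel_poly:
  assumes \<omega>: "\<forall>n\<ge>1. \<omega> n > 0" and "poly (jacobi_poly \<omega> N) x \<noteq> 0"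
  shows "degree (kernel_poly \<omega> x N) = N"
proof (rule antisym)
  show "degree (kernel_poly \<omega> x N) \<le> N"
    unfolding kernel_poly_def by (rule degree_sum_le) (auto intro: order.trans[OF degree_smult_le])
  have "coeff (kernel_poly \<omega> x N) N
      = (\<Sum>k\<le>N. poly (jacobi_poly \<omega> k) x / jacobi_norm \<omega> k * coeff (jacobi_poly \<omega> k) N)"
    by (simp add: kernel_poly_def coeff_sum)
  also have "\<dots> = (\<Sum>k\<in>{N}. poly (jacobi_poly \<omega> k) x / jacobi_norm \<omega> k * coeff (jacobi_poly \<omega> k) N)"
    by (rule sum.mono_neutral_right) (auto intro!: coeff_eq_0)
  also have "\<dots> \<noteq> 0" using assms(2) jacobi_norm_pos[OF \<omega>, of N] by simp
  finally show "N \<le> degree (kernel_poly \<omega> x N)" by (rule le_degree)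
qed

section \<open>Gauss quadrature with a prescribed node\<close>

text \<open>
  The remainder after division by the quadratic is real and linear and vanishes at a nonreal point, hence
  it is zero.
\<close>
lemma real_quadratic_dvd_of_nonreal_root:
  fixes p :: "real poly"
  assumes root: "poly (map_poly complex_of_real p) z = 0" and "Im z \<noteq> 0"
  shows "[:(Re z)\<^sup>2 + (Im z)\<^sup>2, - 2 * Re z, 1:] dvd p"
proof -
  define s where "s = [:(Re z)\<^sup>2 + (Im z)\<^sup>2, - 2 * Re z, 1:]"
  define r where "r = p mod s"
  have hom: "map_poly complex_of_real (s * g + r) =
      map_poly complex_of_real s * map_poly complex_of_real g + map_poly complex_of_real r" for g
    by (rule poly_eqI) (simp add: coeff_map_poly coeff_mult)
  have "p = s * (p div s) + r" by (simp add: r_def)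
  then have "poly (map_poly complex_of_real s) z * poly (map_poly complex_of_real (p div s)) z
      + poly (map_poly complex_of_real r) z = 0"
    using root hom[of "p div s"] by (metis poly_add poly_mult)
  moreover have "poly (map_poly complex_of_real s) z = 0"
    by (simp add: s_def map_poly_pCons complex_eq_iff power2_eq_square algebra_simps)
  ultimately have rz: "poly (map_poly complex_of_real r) z = 0" by simp
  have "degree r \<le> 1"
    using degree_mod_less[of s p] by (auto simp: r_def s_def)
  then obtain c e where r: "r = [:c, e:]"
    by (metis degree1_coeffs degree_eq_zeroE le_eq_less_or_eq less_one pCons_0_0)
  have "e = 0" using rz assms(2) by (auto simp: r map_poly_pCons complex_eq_iff)
  then have "c = 0" using rz by (auto simp: r map_poly_pCons complex_eq_iff)
  then have "r = 0" using r \<open>e = 0\<close> by simp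
  then show ?thesis by (simp add: r_def s_def mod_eq_0_iff_dvd)
qed

text \<open>
  The quadratics in the hypothesis are the \<open>(x - a)\<^sup>2 + b\<^sup>2\<close>. The case \<open>b \<noteq> 0\<close> forbids nonreal roots, and the
  case \<open>b = 0\<close> forbids double roots, so that dividing out a root supplied by the fundamental theorem of
  algebra loses exactly one root.
\<close>
lemma card_real_roots_eq_degree:
  fixes p :: "real poly"
  assumes "p \<noteq> 0" and "\<And>a b. \<not> [:a\<^sup>2 + b\<^sup>2, - 2 * a, 1:] dvd p"
  shows "card {x. poly p x = 0} = degree p"
  using assms
proof (induction "degree p" arbitrary: p)
  case 0
  then obtain c where "p = [:c:]" "c \<noteq> 0" by (metis degree_eq_zeroE pCons_0_0)
  then show ?case by simp
next
  case (Suc n)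
  have "\<not> constant (poly (map_poly complex_of_real p))"
    using Suc.hyps(2) constant_degree[of "map_poly complex_of_real p"]
    by (simp add: degree_map_poly)
  then obtain z where z: "poly (map_poly complex_of_real p) z = 0"
    using fundamental_theorem_of_algebra by blast
  define a where "a = Re z"
  have "Im z = 0"
    using real_quadratic_dvd_of_nonreal_root[OF z] Suc.prems(2)[of "Re z" "Im z"] by blast
  then have "z = complex_of_real a" by (simp add: a_def complex_eq_iff)
  then have "poly p a = 0" using z
    by (simp add: poly_altdef degree_map_poly coeff_map_poly flip: of_real_power of_real_mult of_real_sum)
  then obtain g where p: "p = [:-a, 1:] * g" by (auto simp: poly_eq_0_iff_dvd)
  then have "g \<noteq> 0" using Suc.prems(1) by auto
  then have deg: "degree p = Suc (degree g)" by (simp add: p degree_mult_eq del: mult_pCons_left)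
  have "card {x. poly g x = 0} = degree g"
  proof (rule Suc.hyps(1))
    show "n = degree g" using Suc.hyps(2) deg by simp
    show "\<not> [:c\<^sup>2 + b\<^sup>2, - 2 * c, 1:] dvd g" for c b
      using Suc.prems(2)[of c b] by (auto simp: p simp del: mult_pCons_left)
  qed fact
  moreover have "poly g a \<noteq> 0"
  proof
    assume "poly g a = 0"
    then obtain h where "g = [:-a, 1:] * h" by (auto simp: poly_eq_0_iff_dvd)
    then have "p = ([:-a, 1:] * [:-a, 1:]) * h" by (simp only: p mult.assoc)
    also have "[:-a, 1:] * [:-a, 1:] = [:a\<^sup>2 + 0\<^sup>2, - 2 * a, 1:]"
      by (simp add: power2_eq_square)
    finally have "p = [:a\<^sup>2 + 0\<^sup>2, - 2 * a, 1:] * h" .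
    then show False using Suc.prems(2)[of a 0] by (metis dvd_triv_left)
  qed
  moreover have "{x. poly p x = 0} = insert a {x. poly g x = 0}" by (auto simp: p)
  moreover have "finite {x. poly g x = 0}" using \<open>g \<noteq> 0\<close> by (rule poly_roots_finite)
  ultimately show ?case by (simp add: deg)
qed

text \<open>
  If \<open>Q = ((x - a)\<^sup>2 + b\<^sup>2) g\<close>, then the functional is positive on
  \<open>Q g = ((x - a) g)\<^sup>2 + (b g)\<^sup>2\<close>. But \<open>g\<close> has degree less than \<open>d\<close>, and \<open>Q\<close> is orthogonal to it. As an
  orthogonal polynomial of degree \<open>d + 1\<close> would be orthogonal to degree \<open>d\<close> as well, there is one free
  parameter in \<open>Q\<close>, which is used below to prescribe a node.
\<close>
lemma quasi_orthogonal_roots: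
  assumes pos: "\<And>g. g \<noteq> 0 \<Longrightarrow> moment_functional m (g * g) > 0"
    and deg: "degree Q = Suc d"
    and orth: "\<And>g. degree g < d \<Longrightarrow> moment_functional m (Q * g) = 0"
  shows "card {x. poly Q x = 0} = Suc d"
proof -
  have "Q \<noteq> 0" using deg by auto
  have "\<not> [:a\<^sup>2 + b\<^sup>2, - 2 * a, 1:] dvd Q" for a b
  proof
    assume "[:a\<^sup>2 + b\<^sup>2, - 2 * a, 1:] dvd Q"
    then obtain g where Q: "Q = [:a\<^sup>2 + b\<^sup>2, - 2 * a, 1:] * g" by auto
    then have "g \<noteq> 0" using \<open>Q \<noteq> 0\<close> by auto
    then have "Suc d = 2 + degree g" using deg by (simp add: Q degree_mult_eq del: mult_pCons_left)
    then have "moment_functional m (Q * g) = 0" by (intro orth) simp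
    moreover have "Q * g = ([:-a, 1:] * g) * ([:-a, 1:] * g) + smult (b\<^sup>2) (g * g)"
    proof -
      have "[:a\<^sup>2 + b\<^sup>2, - 2 * a, 1:] = [:-a, 1:] * [:-a, 1:] + [:b\<^sup>2:]"
        by (simp add: power2_eq_square)
      then have "Q * g = ([:-a, 1:] * [:-a, 1:] + [:b\<^sup>2:]) * g * g" by (simp only: Q)
      also have "\<dots> = ([:-a, 1:] * g) * ([:-a, 1:] * g) + [:b\<^sup>2:] * (g * g)"
        by (simp only: distrib_right mult.assoc mult.left_commute[of g])
      finally show ?thesis by simp
    qed
    moreover have "moment_functional m (([:-a, 1:] * g) * ([:-a, 1:] * g)) > 0"
      using \<open>g \<noteq> 0\<close> by (intro pos) (simp del: mult_pCons_left)
    moreover have "moment_functional m (smult (b\<^sup>2) (g * g)) \<ge> 0"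
      using pos[OF \<open>g \<noteq> 0\<close>] by (simp add: moment_functional_smult)
    ultimately show False by (simp only: moment_functional_add)
  qed
  then show ?thesis using card_real_roots_eq_degree[OF \<open>Q \<noteq> 0\<close>] deg by simp
qed

definition lagrange_basis :: "real set \<Rightarrow> real \<Rightarrow> real poly" where
  "lagrange_basis X x = smult (1 / (\<Prod>y\<in>X - {x}. x - y)) (\<Prod>y\<in>X - {x}. [:-y, 1:])"

lemma poly_lagrange_basis:
  assumes "finite X" "x \<in> X" "y \<in> X"
  shows "poly (lagrange_basis X x) y = (if y = x then 1 else 0)"
proof (cases "y = x")
  case True
  have "(\<Prod>y\<in>X - {x}. x - y) \<noteq> 0" using assms(1) by auto
  then show ?thesis using True by (simp add: lagrange_basis_def poly_prod)
next
  case False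
  have "(\<Prod>z\<in>X - {x}. y - z) = 0" using assms False by (intro prod_zero) auto
  then show ?thesis using False by (simp add: lagrange_basis_def poly_prod)
qed

lemma degree_lagrange_basis:
  assumes "finite X" "x \<in> X"
  shows "degree (lagrange_basis X x) < card X"
proof -
  have "degree (\<Prod>y\<in>X - {x}. [:-y, 1:]) \<le> (\<Sum>y\<in>X - {x}. degree [:-y, 1:])"
    using degree_prod_sum_le[of "X - {x}" "\<lambda>y. [:-y, 1:]"] assms(1) by (simp add: o_def)
  also have "\<dots> = card X - 1" using assms by simp
  also have "\<dots> < card X" using card_gt_0_iff[of X] assms by fastforce
  finally show ?thesis
    unfolding lagrange_basis_def by (rule le_less_trans[OF degree_smult_le])
qed

lemma lagrange_interpolation:
  fixes p :: "real poly"
  assumes "finite X" "degree p < card X"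
  shows "p = (\<Sum>x\<in>X. smult (poly p x) (lagrange_basis X x))"
proof (rule poly_eqI_degree[of X])
  show "poly p y = poly (\<Sum>x\<in>X. smult (poly p x) (lagrange_basis X x)) y" if "y \<in> X" for y
  proof -
    have "poly (\<Sum>x\<in>X. smult (poly p x) (lagrange_basis X x)) y
        = (\<Sum>x\<in>X. if x = y then poly p y else 0)"
      unfolding poly_sum using assms(1) that
      by (intro sum.cong) (auto simp: poly_lagrange_basis)
    then show ?thesis using assms(1) that by simp
  qed
  have "X \<noteq> {}" using assms(2) by auto
  then have "card X > 0" using assms(1) by (simp add: card_gt_0_iff)
  then show "degree (\<Sum>x\<in>X. smult (poly p x) (lagrange_basis X x)) < card X"
    using assms(1) degree_lagrange_basis
    by (intro degree_sum_less) (auto intro: le_less_trans[OF degree_smult_le])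
qed fact

text \<open>
  Dividing \<open>p\<close> by \<open>Q\<close>, the functional kills the multiple of \<open>Q\<close>, and the remainder is recovered from its
  values at the roots of \<open>Q\<close> by Lagrange interpolation. The weights are the values of the functional on
  the Lagrange basis; applying the formula to the square of a basis polynomial shows that they are
  positive.
\<close>
lemma gauss_quadrature:
  assumes pos: "\<And>g. g \<noteq> 0 \<Longrightarrow> moment_functional m (g * g) > 0"
    and deg: "degree Q = Suc d"
    and orth: "\<And>g. degree g < d \<Longrightarrow> moment_functional m (Q * g) = 0"
  obtains w where "\<And>x. poly Q x = 0 \<Longrightarrow> w x > 0"
    and "\<And>p. degree p \<le> 2 * d \<Longrightarrow>
           moment_functional m p = (\<Sum>x | poly Q x = 0. w x * poly p x)"
proof -
  define X where "X = {x. poly Q x = 0}"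
  have "Q \<noteq> 0" using deg by auto
  then have fin: "finite X" unfolding X_def by (rule poly_roots_finite)
  have card: "card X = Suc d"
    unfolding X_def using pos deg orth by (rule quasi_orthogonal_roots)
  define w where "w x = moment_functional m (lagrange_basis X x)" for x
  have exact: "moment_functional m p = (\<Sum>x\<in>X. w x * poly p x)" if "degree p \<le> 2 * d" for p
  proof -
    define r where "r = p mod Q"
    have "degree r < Suc d"
      using degree_mod_less[of Q p] \<open>Q \<noteq> 0\<close> deg by (auto simp: r_def)
    have "moment_functional m (Q * (p div Q)) = 0"
    proof (cases "d = 0")
      case True
      then have "p div Q = 0" using that deg by (intro div_poly_less) simp
      then show ?thesis by simp
    next
      case False
      have "degree (p div Q) < d"
      proof (cases "p div Q = 0")
        case nz: False
        have "Suc d + degree (p div Q) = degree (Q * (p div Q))"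
          using nz \<open>Q \<noteq> 0\<close> by (simp add: degree_mult_eq deg)
        also have "Q * (p div Q) = p - r" by (simp add: r_def minus_mod_eq_mult_div)
        also have "degree (p - r) \<le> 2 * d"
          using that \<open>degree r < Suc d\<close> False by (intro degree_diff_le) auto
        finally show ?thesis by simp
      qed (use False in simp)
      then show ?thesis by (rule orth)
    qed
    moreover have "p = Q * (p div Q) + r" by (simp add: r_def)
    ultimately have "moment_functional m p = moment_functional m r"
      by (metis moment_functional_add add_0)
    also have "r = (\<Sum>x\<in>X. smult (poly r x) (lagrange_basis X x))"
      using fin \<open>degree r < Suc d\<close> card by (intro lagrange_interpolation) auto
    also have "moment_functional m \<dots> = (\<Sum>x\<in>X. w x * poly r x)"
      by (simp add: moment_functional_sum moment_functional_smult w_def mult.commute)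
    also have "\<dots> = (\<Sum>x\<in>X. w x * poly p x)"
    proof (rule sum.cong)
      fix x assume "x \<in> X"
      then have "poly Q x = 0" by (simp add: X_def)
      then have "poly p x = poly r x"
        using \<open>p = Q * (p div Q) + r\<close> by (metis add_0 mult_zero_left poly_add poly_mult)
      then show "w x * poly r x = w x * poly p x" by simp
    qed simp
    finally show ?thesis .
  qed
  have "w x > 0" if "x \<in> X" for x
  proof -
    let ?l = "lagrange_basis X x"
    have "degree ?l \<le> d" using degree_lagrange_basis[OF fin that] card by simp
    then have "degree (?l * ?l) \<le> 2 * d" using degree_mult_le[of ?l ?l] by simp
    then have "moment_functional m (?l * ?l) = (\<Sum>y\<in>X. w y * poly (?l * ?l) y)" by (rule exact)
    also have "\<dots> = (\<Sum>y\<in>X. if y = x then w x else 0)"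
      using fin that by (intro sum.cong) (auto simp: poly_lagrange_basis)
    also have "\<dots> = w x" using fin that by simp
    finally have "moment_functional m (?l * ?l) = w x" .
    moreover have "?l \<noteq> 0" using poly_lagrange_basis[OF fin that that] by auto
    ultimately show ?thesis using pos[of ?l] by simp
  qed
  then show thesis using exact that unfolding X_def by auto
qed

text \<open>
  With \<open>K\<close> the kernel polynomial at \<open>a\<close>, the polynomial \<open>(x - a) K\<close> is orthogonal to all \<open>g\<close> of degree
  below \<open>N\<close>: by the reproducing property the value on \<open>(x - a) g K\<close> is that of \<open>(x - a) g\<close> at \<open>a\<close>. Its
  roots are therefore quadrature nodes, and \<open>a\<close> is one of them. As \<open>K\<close> vanishes at all other nodes, the
  quadrature formula for \<open>K\<close> itself reads \<open>1 = w a * K a\<close>. The condition on \<open>P\<^sub>N(a)\<close> ensures that \<open>K\<close> has full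
  degree \<open>N\<close>.
\<close>
lemma jacobi_quadrature_with_node:
  assumes \<omega>: "\<forall>n\<ge>1. \<omega> n > 0" and nz: "poly (jacobi_poly \<omega> N) a \<noteq> 0"
  obtains X w where "finite X" "a \<in> X" "\<And>x. x \<in> X \<Longrightarrow> w x > (0::real)"
    and "\<And>p. degree p \<le> 2 * N \<Longrightarrow> jacobi_functional \<omega> p = (\<Sum>x\<in>X. w x * poly p x)"
    and "w a = 1 / (\<Sum>k\<le>N. (poly (jacobi_poly \<omega> k) a)\<^sup>2 / jacobi_norm \<omega> k)"
proof -
  let ?K = "kernel_poly \<omega> a N"
  define Q where "Q = [:-a, 1:] * ?K"
  have degK: "degree ?K = N" using \<omega> nz by (rule degree_kernel_poly)
  have "?K \<noteq> 0"
    using jacobi_functional_kernel_poly[OF \<omega>, of 1 N a] by auto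
  then have deg: "degree Q = Suc N" by (simp add: Q_def degree_mult_eq degK del: mult_pCons_left)
  have orth: "jacobi_functional \<omega> (Q * g) = 0" if "degree g < N" for g
  proof -
    have "degree ([:-a, 1:] * g) \<le> N"
      using degree_mult_le[of "[:-a, 1:]" g] that by simp
    then have "jacobi_functional \<omega> (([:-a, 1:] * g) * ?K) = poly ([:-a, 1:] * g) a"
      by (rule jacobi_functional_kernel_poly[OF \<omega>])
    then show ?thesis by (simp add: Q_def ac_simps del: mult_pCons_left mult_pCons_right)
  qed
  obtain w where w: "\<And>x. poly Q x = 0 \<Longrightarrow> w x > 0"
    and exact: "\<And>p. degree p \<le> 2 * N \<Longrightarrow>
           jacobi_functional \<omega> p = (\<Sum>x | poly Q x = 0. w x * poly p x)"
    using gauss_quadrature[OF jacobi_functional_positive[OF \<omega>] deg orth] by blast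
  have fin: "finite {x. poly Q x = 0}" using deg by (intro poly_roots_finite) auto
  have aQ: "poly Q a = 0" by (simp add: Q_def)
  \<comment> \<open>Evaluating \<open>K\<close> in two ways isolates the weight at \<open>a\<close>.\<close>
  have "1 = jacobi_functional \<omega> (1 * ?K)"
    using jacobi_functional_kernel_poly[OF \<omega>, of 1 N a] by simp
  also have "\<dots> = (\<Sum>x | poly Q x = 0. w x * poly ?K x)"
    using exact[of ?K] degK by simp
  also have "\<dots> = (\<Sum>x\<in>{a}. w x * poly ?K x)"
    using fin aQ by (intro sum.mono_neutral_right) (auto simp: Q_def)
  finally have "w a = 1 / poly ?K a"
    by (cases "poly ?K a = 0") (auto simp: field_simps)
  then show thesis using that[OF fin, of w] w exact aQ by (simp add: poly_kernel_poly_self)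
qed

section \<open>Limits of measures with convergent moments\<close>

lemma discrete_real_distribution:
  fixes X :: "real set" and w :: "real \<Rightarrow> real"
  assumes fin: "finite X" and pos: "\<And>x. x \<in> X \<Longrightarrow> w x \<ge> 0" and total: "(\<Sum>x\<in>X. w x) = 1"
  obtains \<nu> where "real_distribution \<nu>"
    and "\<And>f :: real \<Rightarrow> real. f \<in> borel_measurable borel \<Longrightarrow>
           integrable \<nu> f \<and> (\<integral>x. f x \<partial>\<nu>) = (\<Sum>x\<in>X. w x * f x)"
proof -
  define u where "u x = (if x \<in> X then w x else 0)" for x
  have nonneg: "\<And>x. u x \<ge> 0" using pos by (simp add: u_def)
  have "(\<integral>\<^sup>+x. ennreal (u x) \<partial>count_space UNIV) = (\<Sum>x\<in>X. ennreal (u x))"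
    using fin by (intro nn_integral_count_space') (auto simp: u_def)
  also have "\<dots> = ennreal (\<Sum>x\<in>X. u x)"
    using nonneg by (intro sum_ennreal)
  also have "\<dots> = 1" using total by (simp add: u_def)
  finally have total': "(\<integral>\<^sup>+x. ennreal (u x) \<partial>count_space UNIV) = 1" .
  define p where "p = embed_pmf u"
  have pmf: "pmf p x = u x" for x
    unfolding p_def by (rule pmf_embed_pmf[OF nonneg total'])
  have supp: "set_pmf p \<subseteq> X"
    by (auto simp: set_pmf_eq pmf u_def split: if_splits)
  define \<nu> where "\<nu> = distr (measure_pmf p) borel (\<lambda>x. x)"
  show thesis
  proof (rule that[of \<nu>])
    show "real_distribution \<nu>"
      unfolding \<nu>_def by (intro prob_space.real_distribution_distr measure_pmf.prob_space_axioms) simp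
    show "integrable \<nu> f \<and> (\<integral>x. f x \<partial>\<nu>) = (\<Sum>x\<in>X. w x * f x)"
      if [measurable]: "f \<in> borel_measurable borel" for f :: "real \<Rightarrow> real"
    proof
      show "integrable \<nu> f"
        unfolding \<nu>_def using finite_subset[OF supp fin]
        by (subst integrable_distr_eq) (auto intro: integrable_measure_pmf_finite)
      have "(\<integral>x. f x \<partial>\<nu>) = (\<integral>x. f x \<partial>measure_pmf p)"
        unfolding \<nu>_def by (subst integral_distr) auto
      also have "\<dots> = (\<Sum>x\<in>X. f x * pmf p x)"
        using fin supp by (intro integral_measure_pmf_real) auto
      also have "\<dots> = (\<Sum>x\<in>X. w x * f x)"
        by (intro sum.cong) (auto simp: pmf u_def)
      finally show "(\<integral>x. f x \<partial>\<nu>) = (\<Sum>x\<in>X. w x * f x)" .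
    qed
  qed
qed

lemma tight_of_second_moments:
  assumes distr: "\<And>k. real_distribution (\<sigma> k)"
    and int: "\<And>k. integrable (\<sigma> k) (\<lambda>x. x\<^sup>2)"
    and mom: "\<And>k. (\<integral>x. x\<^sup>2 \<partial>\<sigma> k) = c"
  shows "tight \<sigma>"
  unfolding tight_def
proof (intro conjI allI impI)
  fix \<epsilon> :: real assume "\<epsilon> > 0"
  have "c \<ge> 0" unfolding mom[of 0, symmetric] by (rule Bochner_Integration.integral_nonneg) simp
  \<comment> \<open>Markov bounds the mass outside \<open>[- R, R]\<close> by \<open>c / R\<^sup>2\<close>; the summand \<open>1\<close> makes this smaller than \<open>\<epsilon>\<close>.\<close>
  define R where "R = sqrt ((c + 1) / \<epsilon>)"
  have "R > 0" and R2: "R\<^sup>2 = (c + 1) / \<epsilon>"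
    using \<open>\<epsilon> > 0\<close> \<open>c \<ge> 0\<close> by (auto simp: R_def)
  have "measure (\<sigma> k) {- R<..R} > 1 - \<epsilon>" for k
  proof -
    interpret real_distribution "\<sigma> k" by (rule distr)
    have "prob {x \<in> space (\<sigma> k). x\<^sup>2 \<ge> R\<^sup>2} \<le> (\<integral>x. x\<^sup>2 \<partial>\<sigma> k) / R\<^sup>2"
      using int[of k] \<open>R > 0\<close> by (intro integral_Markov_inequality_measure[of _ _ "{}"]) auto
    also have "\<dots> = \<epsilon> * (c / (c + 1))" using R2 by (simp add: mom)
    also have "\<dots> < \<epsilon> * 1" using \<open>\<epsilon> > 0\<close> \<open>c \<ge> 0\<close> by (intro mult_strict_left_mono) auto
    finally have small: "prob {x. x\<^sup>2 \<ge> R\<^sup>2} < \<epsilon>" by simp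
    have "x \<in> {- R<..R} \<union> {x. x\<^sup>2 \<ge> R\<^sup>2}" for x
      using abs_le_square_iff[of R x] \<open>R > 0\<close> by auto
    then have "space (\<sigma> k) = {- R<..R} \<union> {x. x\<^sup>2 \<ge> R\<^sup>2}"
      unfolding space_eq_univ by blast
    then have "1 = prob ({- R<..R} \<union> {x. x\<^sup>2 \<ge> R\<^sup>2})" using prob_space by simp
    also have "\<dots> \<le> prob {- R<..R} + prob {x. x\<^sup>2 \<ge> R\<^sup>2}"
      by (rule measure_Un_le) auto
    finally show ?thesis using small by linarith
  qed
  then show "\<exists>a b. a < b \<and> (\<forall>k. measure (\<sigma> k) {a<..b} > 1 - \<epsilon>)"
    using \<open>R > 0\<close> by (intro exI[of _ "- R"] exI[of _ R]) auto
qed (rule distr)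

text \<open>
  Truncation makes the powers of \<open>x\<close> bounded and continuous, hence admissible as test functions for weak
  convergence.
\<close>
definition clip :: "real \<Rightarrow> real \<Rightarrow> real" where
  "clip R x = max (- R) (min R x)"

lemma abs_clip_le: "R \<ge> 0 \<Longrightarrow> \<bar>clip R x\<bar> \<le> R" and abs_clip_le_abs: "R \<ge> 0 \<Longrightarrow> \<bar>clip R x\<bar> \<le> \<bar>x\<bar>"
  and abs_clip_mono: "0 \<le> R \<Longrightarrow> R \<le> S \<Longrightarrow> \<bar>clip R x\<bar> \<le> \<bar>clip S x\<bar>"
  and clip_eq: "\<bar>x\<bar> \<le> R \<Longrightarrow> clip R x = x"
  by (auto simp: clip_def)

lemma isCont_clip_power: "isCont (\<lambda>x. clip R x ^ n) x"
  unfolding clip_def by (intro continuous_intros)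

lemma measurable_clip [measurable]: "(\<lambda>x. clip R x ^ n) \<in> borel_measurable borel"
  by (intro borel_measurable_continuous_onI) (auto intro: continuous_at_imp_continuous_on isCont_clip_power)

lemma tendsto_clip: "(\<lambda>j. clip (real j) x ^ n) \<longlonglongrightarrow> x ^ n"
proof (rule tendsto_eventually)
  have "\<forall>\<^sub>F j in sequentially. real j \<ge> \<bar>x\<bar>"
    using filterlim_real_sequentially by (simp add: filterlim_at_top)
  then show "\<forall>\<^sub>F j in sequentially. clip (real j) x ^ n = x ^ n"
    by eventually_elim (simp add: clip_eq)
qed

text \<open>
  Where the truncation changes \<open>x\<close>, the factor \<open>(\<bar>x\<bar> / R)\<^sup>n\<close> is at least \<open>1\<close>. So a moment of order \<open>2 n\<close> controls
  the truncation error in the moment of order \<open>n\<close>.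
\<close>
lemma clip_power_error:
  assumes "R > 0"
  shows "\<bar>clip R x ^ n - x ^ n\<bar> \<le> 2 / R ^ n * x ^ (2 * n)"
proof (cases "\<bar>x\<bar> \<le> R")
  case True
  then show ?thesis using assms by (simp add: clip_eq)
next
  case False
  have "\<bar>clip R x ^ n - x ^ n\<bar> \<le> \<bar>clip R x\<bar> ^ n + \<bar>x\<bar> ^ n"
    using abs_triangle_ineq4[of "clip R x ^ n" "x ^ n"] by (simp add: power_abs)
  also have "\<dots> \<le> 2 * \<bar>x\<bar> ^ n"
    using power_mono[OF abs_clip_le_abs[of R x], of n] assms by simp
  also have "\<dots> \<le> 2 * (\<bar>x\<bar> ^ n * (\<bar>x\<bar> ^ n / R ^ n))"
  proof -
    have "R ^ n \<le> \<bar>x\<bar> ^ n" using False assms by (intro power_mono) auto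
    then have "1 \<le> \<bar>x\<bar> ^ n / R ^ n" using assms by simp
    then show ?thesis using mult_left_mono[of 1 "\<bar>x\<bar> ^ n / R ^ n" "\<bar>x\<bar> ^ n"] by simp
  qed
  also have "\<dots> = 2 / R ^ n * \<bar>x\<bar> ^ (2 * n)"
    by (simp only: mult_2 power_add) simp
  also have "\<bar>x\<bar> ^ (2 * n) = x ^ (2 * n)" by (simp add: power_even_abs)
  finally show ?thesis .
qed

text \<open>
  Truncated moments converge by weak convergence, and the truncation error is at most \<open>2 m(2n) / R\<^sup>n\<close>
  for all \<open>\<sigma> k\<close> with large \<open>k\<close> at once. The even moments of the limit are finite by monotone convergence,
  after which dominated convergence removes the truncation.
\<close>
lemma moments_of_weak_limit:
  assumes distr: "\<And>k. real_distribution (\<sigma> k)" and M: "real_distribution \<mu>"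
    and conv: "weak_conv_m \<sigma> \<mu>"
    and int: "\<And>n. \<forall>\<^sub>F k in sequentially. integrable (\<sigma> k) (\<lambda>x. x ^ n) \<and> (\<integral>x. x ^ n \<partial>\<sigma> k) = m n"
  shows "integrable \<mu> (\<lambda>x. x ^ n)" and "(\<integral>x. x ^ n \<partial>\<mu>) = m n"
proof -
  interpret \<sigma>: real_distribution "\<sigma> k" for k by (rule distr)
  interpret \<mu>: real_distribution \<mu> by (rule M)
  have int_clip: "integrable N (\<lambda>x. clip R x ^ n)" if "real_distribution N" "R \<ge> 0" for N R n
  proof -
    interpret real_distribution N by fact
    show ?thesis
      using abs_clip_le[OF \<open>R \<ge> 0\<close>]
      by (intro integrable_const_bound[where B = "R ^ n"]) (auto simp: power_abs intro!: power_mono AE_I2)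
  qed
  have lim: "(\<lambda>k. \<integral>x. clip R x ^ n \<partial>\<sigma> k) \<longlonglongrightarrow> (\<integral>x. clip R x ^ n \<partial>\<mu>)" if "R \<ge> 0" for R n
    using abs_clip_le[OF \<open>R \<ge> 0\<close>]
    by (intro weak_conv_imp_integral_bdd_continuous_conv[OF distr M conv, where B = "R ^ n"])
       (auto simp: power_abs isCont_clip_power intro!: power_mono)
  have even: "integrable \<mu> (\<lambda>x. x ^ (2 * n))" for n
  proof -
    let ?I = "\<lambda>j. \<integral>x. clip (real j) x ^ (2 * n) \<partial>\<mu>"
    have mono: "clip (real i) x ^ (2 * n) \<le> clip (real j) x ^ (2 * n)" if "i \<le> j" for i j x
      using power_mono[OF abs_clip_mono[of "real i" "real j" x], of "2 * n"] that
      by (simp add: power_even_abs)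
    have "incseq ?I"
      unfolding incseq_def using M mono by (auto intro!: integral_mono int_clip)
    moreover have "?I j \<le> m (2 * n)" for j
    proof (rule tendsto_upperbound[OF lim])
      show "\<forall>\<^sub>F k in sequentially. (\<integral>x. clip (real j) x ^ (2 * n) \<partial>\<sigma> k) \<le> m (2 * n)"
        using int[of "2 * n"]
      proof eventually_elim
        case (elim k)
        have "(\<integral>x. clip (real j) x ^ (2 * n) \<partial>\<sigma> k) \<le> (\<integral>x. x ^ (2 * n) \<partial>\<sigma> k)"
        proof (rule integral_mono)
          show "clip (real j) x ^ (2 * n) \<le> x ^ (2 * n)" for x
            using power_mono[OF abs_clip_le_abs[of "real j" x], of "2 * n"] by (simp add: power_even_abs)
        qed (use elim distr int_clip in auto)
        then show ?case using elim by simp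
      qed
    qed auto
    ultimately obtain l where "?I \<longlonglongrightarrow> l"
      using incseq_convergent[of ?I "m (2 * n)"] by blast
    show ?thesis
    proof (rule integrable_monotone_convergence)
      show "integrable \<mu> (\<lambda>x. clip (real j) x ^ (2 * n))" for j
        by (rule int_clip[OF M]) simp
      show "AE x in \<mu>. mono (\<lambda>j. clip (real j) x ^ (2 * n))"
        by (intro AE_I2 monoI mono)
      show "AE x in \<mu>. (\<lambda>j. clip (real j) x ^ (2 * n)) \<longlonglongrightarrow> x ^ (2 * n)"
        by (intro AE_I2 tendsto_clip)
    qed (fact, simp)
  qed
  show all: "integrable \<mu> (\<lambda>x. x ^ n)" for n
  proof (rule Bochner_Integration.integrable_bound)
    show "integrable \<mu> (\<lambda>x. 1 + x ^ (2 * n))" using even by simp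
    have "\<bar>y\<bar> \<le> \<bar>1 + y\<^sup>2\<bar>" for y :: real
    proof -
      have "0 \<le> (\<bar>y\<bar> - 1)\<^sup>2" by simp
      then have "2 * \<bar>y\<bar> \<le> 1 + y\<^sup>2" by (simp add: power2_diff)
      then show ?thesis by linarith
    qed
    from this[of "x ^ n" for x] show "AE x in \<mu>. norm (x ^ n) \<le> norm (1 + x ^ (2 * n))"
      by (simp add: power_even_eq)
  qed simp
  show "(\<integral>x. x ^ n \<partial>\<mu>) = m n"
  proof (cases "n = 0")
    case True
    from int[of 0] have "m 0 = 1"
      using \<sigma>.prob_space by (auto simp: eventually_sequentially)
    then show ?thesis using \<mu>.prob_space True by simp
  next
    case False
    let ?I = "\<lambda>j. \<integral>x. clip (real j) x ^ n \<partial>\<mu>"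
    have bound: "\<bar>?I j - m n\<bar> \<le> 2 / real j ^ n * m (2 * n)" if "j \<ge> 1" for j
    proof (rule tendsto_upperbound)
      show "(\<lambda>k. \<bar>(\<integral>x. clip (real j) x ^ n \<partial>\<sigma> k) - m n\<bar>) \<longlonglongrightarrow> \<bar>?I j - m n\<bar>"
        by (intro tendsto_intros lim) simp
      show "\<forall>\<^sub>F k in sequentially. \<bar>(\<integral>x. clip (real j) x ^ n \<partial>\<sigma> k) - m n\<bar>
              \<le> 2 / real j ^ n * m (2 * n)"
        using int[of n] int[of "2 * n"]
      proof eventually_elim
        case (elim k)
        have ic: "integrable (\<sigma> k) (\<lambda>x. clip (real j) x ^ n)"
          using distr by (intro int_clip) auto
        have "(\<integral>x. clip (real j) x ^ n \<partial>\<sigma> k) - m n = (\<integral>x. clip (real j) x ^ n - x ^ n \<partial>\<sigma> k)"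
          using elim ic by simp
        also have "\<bar>\<dots>\<bar> \<le> (\<integral>x. \<bar>clip (real j) x ^ n - x ^ n\<bar> \<partial>\<sigma> k)"
          by (rule integral_abs_bound)
        also have "\<dots> \<le> (\<integral>x. 2 / real j ^ n * x ^ (2 * n) \<partial>\<sigma> k)"
          using elim ic clip_power_error[of "real j"] that by (intro integral_mono) auto
        also have "\<dots> = 2 / real j ^ n * m (2 * n)" using elim by simp
        finally show ?case .
      qed
    qed auto
    have "(\<lambda>j. 2 / real j ^ n * m (2 * n)) \<longlonglongrightarrow> 0"
    proof -
      have "(\<lambda>j. 2 * inverse (real j) ^ n * m (2 * n)) \<longlonglongrightarrow> 2 * 0 ^ n * m (2 * n)"
        by (intro tendsto_intros lim_inverse_n)
      then show ?thesis using False by (simp add: divide_inverse power_inverse power_0_left)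
    qed
    then have "(\<lambda>j. ?I j - m n) \<longlonglongrightarrow> 0"
      by (rule Lim_null_comparison[rotated])
         (use bound in \<open>auto simp: eventually_sequentially intro!: exI[of _ 1]\<close>)
    then have "?I \<longlonglongrightarrow> m n" by (rule LIM_zero_cancel)
    moreover have "?I \<longlonglongrightarrow> (\<integral>x. x ^ n \<partial>\<mu>)"
    proof (rule integral_dominated_convergence[where w = "\<lambda>x. \<bar>x ^ n\<bar>"])
      show "integrable \<mu> (\<lambda>x. \<bar>x ^ n\<bar>)" using all by (rule integrable_abs)
      show "AE x in \<mu>. norm (clip (real j) x ^ n) \<le> \<bar>x ^ n\<bar>" for j
        using abs_clip_le_abs[of "real j"] by (simp add: power_abs power_mono)
    qed (simp_all add: tendsto_clip)
    ultimately show ?thesis by (rule LIMSEQ_unique[rotated])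
  qed
qed

text \<open>
  A tent function of height \<open>1\<close> at \<open>a\<close> has expectation at least \<open>\<rho>\<close> under every \<open>\<sigma> k\<close>, hence also under the
  limit. Let the tents shrink to the point \<open>a\<close>.
\<close>
lemma atom_of_weak_limit:
  assumes distr: "\<And>k. real_distribution (\<sigma> k)" and M: "real_distribution \<mu>"
    and conv: "weak_conv_m \<sigma> \<mu>" and atom: "\<And>k. measure (\<sigma> k) {a} \<ge> \<rho>"
  shows "measure \<mu> {a} \<ge> \<rho>"
proof -
  interpret \<sigma>: real_distribution "\<sigma> k" for k by (rule distr)
  interpret \<mu>: real_distribution \<mu> by (rule M)
  define bump where "bump j x = max 0 (1 - real j * \<bar>x - a\<bar>)" for j :: nat and x :: real
  have bump_le: "\<bar>bump j x\<bar> \<le> 1" and bump_nonneg: "bump j x \<ge> 0" and [simp]: "bump j a = 1" for j x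
    by (auto simp: bump_def)
  have cont: "isCont (bump j) x" for j x
    unfolding bump_def by (intro continuous_intros)
  then have [measurable]: "bump j \<in> borel_measurable borel" for j
    by (intro borel_measurable_continuous_onI) (auto intro: continuous_at_imp_continuous_on)
  have int: "integrable N (bump j)" if "real_distribution N" for N j
  proof -
    interpret real_distribution N by fact
    show ?thesis using bump_le by (intro integrable_const_bound[where B = 1]) auto
  qed
  have lower: "(\<integral>x. bump j x \<partial>\<mu>) \<ge> \<rho>" for j
  proof (rule tendsto_lowerbound)
    show "(\<lambda>k. \<integral>x. bump j x \<partial>\<sigma> k) \<longlonglongrightarrow> (\<integral>x. bump j x \<partial>\<mu>)"
      using cont bump_le
      by (intro weak_conv_imp_integral_bdd_continuous_conv[OF distr M conv, where B = 1]) auto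
    have "\<rho> \<le> (\<integral>x. bump j x \<partial>\<sigma> k)" for k
    proof -
      have "\<rho> \<le> (\<integral>x. indicator {a} x \<partial>\<sigma> k)" using atom[of k] by simp
      also have "\<dots> \<le> (\<integral>x. bump j x \<partial>\<sigma> k)"
      proof (rule integral_mono)
        show "integrable (\<sigma> k) (indicator {a} :: real \<Rightarrow> real)"
          by (simp add: \<sigma>.emeasure_eq_measure)
        show "indicator {a} x \<le> bump j x" for x
          using bump_nonneg by (auto simp: indicator_def)
      qed (rule int[OF distr])
      finally show ?thesis .
    qed
    then show "\<forall>\<^sub>F k in sequentially. \<rho> \<le> (\<integral>x. bump j x \<partial>\<sigma> k)" by simp
  qed simp
  have "(\<lambda>j. \<integral>x. bump j x \<partial>\<mu>) \<longlonglongrightarrow> (\<integral>x. indicator {a} x \<partial>\<mu>)"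
  proof (rule integral_dominated_convergence[where w = "\<lambda>_. 1"])
    have "(\<lambda>j. bump j x) \<longlonglongrightarrow> indicator {a} x" for x
    proof (cases "x = a")
      case False
      have "\<forall>\<^sub>F j in sequentially. real j \<ge> 1 / \<bar>x - a\<bar>"
        using filterlim_real_sequentially by (simp add: filterlim_at_top)
      then have "\<forall>\<^sub>F j in sequentially. bump j x = indicator {a} x"
        by eventually_elim (use False in \<open>auto simp: bump_def field_simps\<close>)
      then show ?thesis by (rule tendsto_eventually)
    qed simp
    then show "AE x in \<mu>. (\<lambda>j. bump j x) \<longlonglongrightarrow> indicator {a} x" by simp
  qed (use bump_le in auto)
  then have "(\<integral>x. indicator {a} x \<partial>\<mu>) \<ge> \<rho>"
    using lower by (intro LIMSEQ_le_const) auto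
  then show ?thesis by simp
qed

lemma measure_with_moments_and_atom:
  assumes distr: "\<And>k. real_distribution (\<nu> k)"
    and int: "\<And>n k. n \<le> 2 * k \<Longrightarrow> integrable (\<nu> k) (\<lambda>x. x ^ n) \<and> (\<integral>x. x ^ n \<partial>\<nu> k) = m n"
    and atom: "\<And>k. measure (\<nu> k) {a} \<ge> \<rho>"
  obtains \<mu> where "real_distribution \<mu>" "\<And>n. integrable \<mu> (\<lambda>x. x ^ n)"
    "\<And>n. (\<integral>x. x ^ n \<partial>\<mu>) = m n" "measure \<mu> {a} \<ge> \<rho>"
proof -
  \<comment> \<open>The shift is needed because the second moment of \<open>\<nu> 0\<close> is not prescribed.\<close>
  have "tight (\<lambda>k. \<nu> (Suc k))"
    using distr int[of 2] by (intro tight_of_second_moments[where c = "m 2"]) auto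
  from tight_imp_convergent_subsubsequence[OF this strict_mono_id]
  obtain r \<mu> where r: "strict_mono r" and \<mu>: "real_distribution \<mu>"
    and conv: "weak_conv_m (\<lambda>k. \<nu> (Suc (r k))) \<mu>"
    by (auto simp: o_def)
  have int': "\<forall>\<^sub>F k in sequentially.
      integrable (\<nu> (Suc (r k))) (\<lambda>x. x ^ n) \<and> (\<integral>x. x ^ n \<partial>\<nu> (Suc (r k))) = m n" for n
    using eventually_ge_at_top[of n]
  proof eventually_elim
    case (elim k)
    then have "n \<le> 2 * Suc (r k)" using seq_suble[OF r, of k] by simp
    then show ?case by (rule int)
  qed
  show thesis
    using moments_of_weak_limit[OF distr \<mu> conv int'] atom_of_weak_limit[OF distr \<mu> conv atom]
    by (intro that[OF \<mu>]) auto
qed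

section \<open>Realizing measures and moments\<close>

lemma integral_poly:
  assumes int: "\<And>n. integrable \<mu> (\<lambda>x. x ^ n)" and mom: "\<And>n. (\<integral>x. x ^ n \<partial>\<mu>) = m n"
  shows "integrable \<mu> (poly p)" and "(\<integral>x. poly p x \<partial>\<mu>) = moment_functional m p"
proof -
  have eq: "poly p = (\<lambda>x. \<Sum>i\<le>degree p. coeff p i * x ^ i)"
    by (rule ext) (rule poly_altdef)
  show "integrable \<mu> (poly p)" unfolding eq using int by auto
  show "(\<integral>x. poly p x \<partial>\<mu>) = moment_functional m p"
    unfolding eq moment_functional_def using int by (simp add: mom)
qed

text \<open>
  The complement of the support is a union of open null sets, and by Lindelof's theorem countably many of
  them suffice.
\<close>
lemma (in real_distribution) AE_measure_support: "AE x in M. x \<in> measure_support M"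
proof -
  let ?F = "{U. open U \<and> emeasure M U = 0}"
  obtain F' where F': "F' \<subseteq> ?F" "countable F'" "\<Union>F' = \<Union>?F"
    by (rule Lindelof[of ?F]) auto
  have "AE x in M. \<forall>U\<in>F'. x \<notin> U"
    using F' by (subst AE_ball_countable) (auto intro!: AE_not_in simp: null_sets_def)
  then show ?thesis
  proof (rule AE_mp, intro AE_I2 impI)
    fix x assume "\<forall>U\<in>F'. x \<notin> U"
    then have "x \<notin> \<Union>?F" using F'(3) by blast
    then show "x \<in> measure_support M"
      by (auto simp: measure_support_def zero_less_iff_neq_zero)
  qed
qed

text \<open>
  If the support were finite, the square of the polynomial vanishing on it would have expectation zero,
  against positivity.
\<close>
lemma realizes_jacobi_of_moments:
  assumes \<omega>: "\<forall>n\<ge>1. \<omega> n > 0" and \<mu>: "real_distribution \<mu>"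
    and int: "\<And>n. integrable \<mu> (\<lambda>x. x ^ n)"
    and mom: "\<And>n. (\<integral>x. x ^ n \<partial>\<mu>) = dyck_weight \<omega> n 0"
  shows "realizes_jacobi \<mu> \<omega>"
proof -
  interpret real_distribution \<mu> by (rule \<mu>)
  note expect = integral_poly[OF int mom]
  have "infinite (measure_support \<mu>)"
  proof
    assume fin: "finite (measure_support \<mu>)"
    define g where "g = (\<Prod>a\<in>measure_support \<mu>. [:-a, 1:] :: real poly)"
    have "AE x in \<mu>. poly (g * g) x = 0"
      using AE_measure_support
    proof (rule AE_mp, intro AE_I2 impI)
      fix x assume "x \<in> measure_support \<mu>"
      then have "poly g x = 0" unfolding g_def poly_prod using fin by (intro prod_zero) auto
      then show "poly (g * g) x = 0" by simp
    qed
    then have "(\<integral>x. poly (g * g) x \<partial>\<mu>) = 0" by (rule integral_eq_zero_AE)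
    moreover have "g \<noteq> 0" using fin by (simp add: g_def)
    ultimately show False
      using jacobi_functional_positive[OF \<omega>, of g] unfolding expect(2) by simp
  qed
  moreover have "(\<integral>x. poly (jacobi_poly \<omega> j) x * poly (jacobi_poly \<omega> k) x \<partial>\<mu>) = 0" if "j \<noteq> k" for j k
    using expect(2)[of "jacobi_poly \<omega> j * jacobi_poly \<omega> k"] that
    by (simp add: jacobi_functional_orthogonal)
  then have "monic_orthogonal_polys \<mu> (jacobi_poly \<omega>)"
    by (simp add: monic_orthogonal_polys_def)
  ultimately show ?thesis
    unfolding realizes_jacobi_def borel_prob_measure_def finite_moments_def
    using \<omega> int prob_space_axioms jacobi_poly_recurrence by (auto intro!: exI[of _ "jacobi_poly \<omega>"])
qed

text \<open>
  The recurrence determines the orthogonal polynomials, and orthogonality to \<open>P\<^sub>0 = 1\<close> determines the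
  expectation of each of them. As they span all polynomials, the moments are determined as well.
\<close>
lemma moments_of_realizes_jacobi:
  assumes "realizes_jacobi \<mu> \<omega>"
  shows "real_distribution \<mu>" and "integrable \<mu> (\<lambda>x. x ^ n)"
    and "(\<integral>x. x ^ n \<partial>\<mu>) = dyck_weight \<omega> n 0"
proof -
  from assms have \<mu>: "prob_space \<mu>" "sets \<mu> = sets borel"
    and int: "\<And>n. integrable \<mu> (\<lambda>x. x ^ n)"
    unfolding realizes_jacobi_def borel_prob_measure_def finite_moments_def by auto
  show distr: "real_distribution \<mu>"
    using \<mu> by (simp add: real_distribution_def real_distribution_axioms_def)
  show "integrable \<mu> (\<lambda>x. x ^ n)" by (rule int)
  interpret real_distribution \<mu> by (rule distr)
  from assms obtain P where P: "monic_orthogonal_polys \<mu> P"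
    and rec: "\<And>n. [:0, 1:] * P n = P (Suc n) + (if n = 0 then 0 else smult (\<omega> n) (P (n - 1)))"
    unfolding realizes_jacobi_def by blast
  have P0: "P 0 = 1"
  proof -
    have "degree (P 0) = 0" "lead_coeff (P 0) = 1"
      using P unfolding monic_orthogonal_polys_def by blast+
    then show ?thesis by (metis degree_eq_zeroE lead_coeff_pCons(2) one_pCons)
  qed
  have PJ: "P = jacobi_poly \<omega>" using jacobi_poly_unique[OF P0 rec] by blast
  define m where "m n = (\<integral>x. x ^ n \<partial>\<mu>)" for n
  note expect = integral_poly[OF int m_def[symmetric]]
  have basis: "moment_functional m (jacobi_poly \<omega> k) = jacobi_functional \<omega> (jacobi_poly \<omega> k)" for k
  proof -
    have "moment_functional m (jacobi_poly \<omega> k) = (\<integral>x. poly (P k) x * poly (P 0) x \<partial>\<mu>)"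
      by (simp add: P0 PJ flip: expect(2))
    also have "\<dots> = (if k = 0 then 1 else 0)"
    proof (cases "k = 0")
      case False
      then have "(\<integral>x. poly (P k) x * poly (P 0) x \<partial>\<mu>) = 0"
        using P unfolding monic_orthogonal_polys_def by blast
      then show ?thesis using False by simp
    qed (use prob_space in \<open>simp add: P0\<close>)
    also have "\<dots> = jacobi_functional \<omega> (jacobi_poly \<omega> k * jacobi_poly \<omega> 0)"
      by (subst jacobi_functional_orthogonal) simp
    finally show ?thesis by simp
  qed
  have "moment_functional m p = jacobi_functional \<omega> p" for p
  proof -
    have "\<forall>i\<ge>Suc (degree p). coeff p i = 0" by (simp add: coeff_eq_0)
    then show ?thesis
      by (induction p rule: jacobi_basis_induct[where \<omega> = \<omega>])
         (simp_all add: moment_functional_add moment_functional_smult basis)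
  qed
  from this[of "monom 1 n"] show "(\<integral>x. x ^ n \<partial>\<mu>) = dyck_weight \<omega> n 0"
    by (simp add: m_def)
qed

section \<open>Indeterminacy from many atoms\<close>

text \<open>
  Every quadrature measure with node \<open>a\<close> has an atom there whose mass is the reciprocal of a partial sum of
  the series. These masses are at least \<open>1 / \<kappa>\<close>, with \<open>\<kappa>\<close> the sum of the series, and so the atom survives
  in a limit measure.
\<close>
lemma realizing_measure_with_atom:
  assumes \<omega>: "\<forall>n\<ge>1. \<omega> n > 0" and nz: "\<And>N. poly (jacobi_poly \<omega> N) a \<noteq> 0"
    and summ: "summable (\<lambda>k. (poly (jacobi_poly \<omega> k) a)\<^sup>2 / jacobi_norm \<omega> k)"
  obtains \<mu> where "realizes_jacobi \<mu> \<omega>" "measure \<mu> {a} > 0"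
proof -
  let ?t = "\<lambda>k. (poly (jacobi_poly \<omega> k) a)\<^sup>2 / jacobi_norm \<omega> k"
  have t: "?t k \<ge> 0" for k using jacobi_norm_pos[OF \<omega>, of k] by simp
  define \<kappa> where "\<kappa> = suminf ?t"
  have partial: "sum ?t {..N} \<le> \<kappa>" for N
    unfolding \<kappa>_def by (rule sum_le_suminf[OF summ]) (use t in auto)
  have partial_pos: "sum ?t {..N} > 0" for N
  proof -
    have "?t 0 \<le> sum ?t {..N}" using t by (intro member_le_sum) auto
    then show ?thesis by simp
  qed
  have "\<exists>\<nu>. real_distribution \<nu> \<and>
      (\<forall>n\<le>2 * N. integrable \<nu> (\<lambda>x. x ^ n) \<and> (\<integral>x. x ^ n \<partial>\<nu>) = dyck_weight \<omega> n 0) \<and>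
      measure \<nu> {a} \<ge> 1 / \<kappa>" for N
  proof -
    obtain X w where fin: "finite X" and a: "a \<in> X" and w: "\<And>x. x \<in> X \<Longrightarrow> w x > 0"
      and exact: "\<And>p. degree p \<le> 2 * N \<Longrightarrow> jacobi_functional \<omega> p = (\<Sum>x\<in>X. w x * poly p x)"
      and wa: "w a = 1 / sum ?t {..N}"
      using jacobi_quadrature_with_node[OF \<omega> nz] by blast
    have moment: "(\<Sum>x\<in>X. w x * x ^ n) = dyck_weight \<omega> n 0" if "n \<le> 2 * N" for n
      using exact[of "monom 1 n"] that by (simp add: degree_monom_eq poly_monom)
    have "(\<Sum>x\<in>X. w x) = 1" using moment[of 0] by simp
    then obtain \<nu> where \<nu>: "real_distribution \<nu>"
      and int: "\<And>f :: real \<Rightarrow> real. f \<in> borel_measurable borel \<Longrightarrow>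
           integrable \<nu> f \<and> (\<integral>x. f x \<partial>\<nu>) = (\<Sum>x\<in>X. w x * f x)"
      using discrete_real_distribution[of X w] fin w by (metis less_imp_le)
    interpret real_distribution \<nu> by (rule \<nu>)
    have "measure \<nu> {a} = (\<integral>x. indicator {a} x \<partial>\<nu>)" by simp
    also have "\<dots> = (\<Sum>x\<in>X. w x * indicator {a} x)" using int[of "indicator {a}"] by simp
    also have "\<dots> = (\<Sum>x\<in>X. if x = a then w a else 0)" by (intro sum.cong) auto
    also have "\<dots> = 1 / sum ?t {..N}" using fin a wa by simp
    also have "\<dots> \<ge> 1 / \<kappa>" using partial[of N] partial_pos[of N] by (intro divide_left_mono) auto
    finally show ?thesis using \<nu> int moment by (intro exI[of _ \<nu>]) auto
  qed
  then obtain \<nu> where \<nu>: "\<And>N. real_distribution (\<nu> N)"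
    "\<And>n N. n \<le> 2 * N \<Longrightarrow> integrable (\<nu> N) (\<lambda>x. x ^ n) \<and> (\<integral>x. x ^ n \<partial>\<nu> N) = dyck_weight \<omega> n 0"
    "\<And>N. measure (\<nu> N) {a} \<ge> 1 / \<kappa>"
    by metis
  obtain \<mu> where \<mu>: "real_distribution \<mu>" "\<And>n. integrable \<mu> (\<lambda>x. x ^ n)"
    "\<And>n. (\<integral>x. x ^ n \<partial>\<mu>) = dyck_weight \<omega> n 0" "measure \<mu> {a} \<ge> 1 / \<kappa>"
    by (rule measure_with_moments_and_atom[OF \<nu>(1) _ \<nu>(3)]) (erule \<nu>(2), blast intro: that)
  have "\<kappa> > 0" using partial[of 0] partial_pos[of 0] by linarith
  then have "measure \<mu> {a} > 0" using \<mu>(4) by (meson less_le_trans zero_less_divide_1_iff)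
  with realizes_jacobi_of_moments[OF \<omega> \<mu>(1-3)] show thesis by (rule that)
qed

text \<open>
  A unique realizing measure would have an atom at every real number outside a countable set, but a
  finite measure has only countably many atoms.
\<close>
lemma indeterminate_of_summable:
  assumes \<omega>: "\<forall>n\<ge>1. \<omega> n > 0"
    and summ: "\<And>a. summable (\<lambda>k. (poly (jacobi_poly \<omega> k) a)\<^sup>2 / jacobi_norm \<omega> k)"
  shows "indeterminate \<omega>"
proof (rule ccontr)
  assume "\<not> indeterminate \<omega>"
  then have unique: "\<mu> = \<nu>" if "realizes_jacobi \<mu> \<omega>" "realizes_jacobi \<nu> \<omega>" for \<mu> \<nu>
    using that unfolding indeterminate_def by blast
  \<comment> \<open>At the zeros of the \<open>P\<^sub>N\<close> the kernel polynomials lose degree; only countably many points are excluded.\<close>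
  define Z where "Z = (\<Union>N. {x. poly (jacobi_poly \<omega> N) x = 0})"
  have "countable Z"
    unfolding Z_def by (intro countable_UN countableI_type countable_finite poly_roots_finite) simp
  have atom: "\<exists>\<mu>. realizes_jacobi \<mu> \<omega> \<and> measure \<mu> {a} > 0" if "a \<notin> Z" for a
    using realizing_measure_with_atom[OF \<omega> _ summ, of a] that unfolding Z_def by blast
  have "\<not> UNIV \<subseteq> Z"
    using \<open>countable Z\<close> countable_subset uncountable_UNIV_real by blast
  then obtain a \<mu> where \<mu>: "realizes_jacobi \<mu> \<omega>" using atom by blast
  interpret real_distribution \<mu> by (rule moments_of_realizes_jacobi(1)[OF \<mu>])
  have "- Z \<subseteq> {x. measure \<mu> {x} \<noteq> 0}"
  proof
    fix x assume "x \<in> - Z"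
    then obtain \<nu> where "realizes_jacobi \<nu> \<omega>" "measure \<nu> {x} > 0" using atom by blast
    then show "x \<in> {x. measure \<mu> {x} \<noteq> 0}" using unique[OF \<mu>] by auto
  qed
  then have "countable (- Z)" using countable_support countable_subset by blast
  then have "countable (- Z \<union> Z)" using \<open>countable Z\<close> by blast
  then show False using uncountable_UNIV_real by simp
qed

section \<open>Geometric growth\<close>

lemma summable_square_of_recurrence:
  fixes s A B :: "nat \<Rightarrow> real"
  assumes nonneg: "\<And>n. s n \<ge> 0" "\<And>n. A n \<ge> 0" "\<And>n. B n \<ge> 0"
    and rec: "\<And>n. s (Suc (Suc n)) \<le> A n * s (Suc n) + B n * s n"
    and A: "A \<longlonglongrightarrow> 0" and B: "B \<longlonglongrightarrow> \<beta>" and "\<beta> < 1"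
  shows "summable (\<lambda>n. (s n)\<^sup>2)"
proof -
  have "\<beta> \<ge> 0" using B nonneg(3) by (intro LIMSEQ_le_const) auto
  then have "sqrt \<beta> < 1" using \<open>\<beta> < 1\<close> by simp
  \<comment> \<open>Since \<open>\<beta> < \<theta>\<^sup>2\<close>, the recurrence preserves the bound \<open>C * \<theta> ^ n\<close> as soon as \<open>A n * \<theta> + B n < \<theta>\<^sup>2\<close>.\<close>
  then obtain \<theta> where \<theta>: "sqrt \<beta> < \<theta>" "\<theta> < 1" using dense by blast
  have "\<theta> > 0" using \<theta>(1) \<open>\<beta> \<ge> 0\<close> real_sqrt_ge_zero by (meson le_less_trans)
  have "\<beta> < \<theta>\<^sup>2"
    using power_strict_mono[OF \<theta>(1), of 2] \<open>\<beta> \<ge> 0\<close> by simp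
  have "(\<lambda>n. A n * \<theta> + B n) \<longlonglongrightarrow> 0 * \<theta> + \<beta>" by (intro tendsto_intros A B)
  then have "\<forall>\<^sub>F n in sequentially. A n * \<theta> + B n < \<theta>\<^sup>2"
    using \<open>\<beta> < \<theta>\<^sup>2\<close> by (intro order_tendstoD(2)) auto
  then obtain N where N: "\<And>n. n \<ge> N \<Longrightarrow> A n * \<theta> + B n < \<theta>\<^sup>2"
    by (auto simp: eventually_sequentially)
  define C where "C = max (s N / \<theta> ^ N) (s (Suc N) / \<theta> ^ Suc N)"
  have C: "C \<ge> 0" using nonneg(1)[of N] \<open>\<theta> > 0\<close> by (simp add: C_def le_max_iff_disj)
  have bound: "s (N + n) \<le> C * \<theta> ^ (N + n) \<and> s (Suc (N + n)) \<le> C * \<theta> ^ Suc (N + n)" for n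
  proof (induction n)
    case 0
    have "s N / \<theta> ^ N \<le> C" "s (Suc N) / \<theta> ^ Suc N \<le> C" by (auto simp: C_def)
    then show ?case using \<open>\<theta> > 0\<close> by (simp add: pos_divide_le_eq)
  next
    case (Suc n)
    let ?k = "N + n"
    have "s (Suc (Suc ?k)) \<le> A ?k * s (Suc ?k) + B ?k * s ?k" by (rule rec)
    also have "\<dots> \<le> A ?k * (C * \<theta> ^ Suc ?k) + B ?k * (C * \<theta> ^ ?k)"
      using Suc nonneg by (intro add_mono mult_left_mono) auto
    also have "\<dots> = C * \<theta> ^ ?k * (A ?k * \<theta> + B ?k)" by (simp add: algebra_simps)
    also have "\<dots> \<le> C * \<theta> ^ ?k * \<theta>\<^sup>2"
      using C \<open>\<theta> > 0\<close> N[of ?k] by (intro mult_left_mono) auto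
    also have "\<dots> = C * \<theta> ^ Suc (Suc ?k)" by (simp add: power2_eq_square)
    finally show ?case using Suc by simp
  qed
  show ?thesis
  proof (rule summable_comparison_test')
    have "\<bar>\<theta>\<^sup>2\<bar> < 1" using \<theta>(2) \<open>\<theta> > 0\<close> by (simp add: power_less_one_iff)
    then show "summable (\<lambda>n. C\<^sup>2 * (\<theta>\<^sup>2) ^ n)" by (intro summable_mult summable_geometric) simp
    show "norm ((s n)\<^sup>2) \<le> C\<^sup>2 * (\<theta>\<^sup>2) ^ n" if "n \<ge> N" for n
    proof -
      have "s n \<le> C * \<theta> ^ n" using bound[of "n - N"] that by simp
      then have "(s n)\<^sup>2 \<le> (C * \<theta> ^ n)\<^sup>2" using nonneg(1) by (intro power_mono)
      then show ?thesis by (simp add: power_mult_distrib flip: power_mult) (simp add: mult.commute)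
    qed
  qed
qed

text \<open>
  After normalization by the square root of \<open>jacobi_norm \<omega> n\<close>, the recurrence at a fixed point \<open>a\<close> has the
  coefficients \<open>\<bar>a\<bar> / sqrt (\<omega> (n + 2))\<close>, which tend to zero, and \<open>sqrt (\<omega> (n + 1) / \<omega> (n + 2))\<close>, which tend to a
  limit below one. So the normalized polynomials decay geometrically at \<open>a\<close>.
\<close>
lemma indeterminate_of_geometric_growth:
  assumes \<omega>: "\<forall>n\<ge>1. \<omega> n > 0"
    and ratio: "(\<lambda>n. \<omega> (Suc n) / \<omega> (Suc (Suc n))) \<longlonglongrightarrow> r" and "r < 1"
  shows "indeterminate \<omega>"
proof (rule indeterminate_of_summable[OF \<omega>])
  fix a
  have pos: "\<omega> (Suc n) > 0" for n using \<omega> by simp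
  obtain c where c: "r < c" "c < 1" using dense[OF \<open>r < 1\<close>] by blast
  obtain N where N: "\<And>n. n \<ge> N \<Longrightarrow> \<omega> (Suc n) / \<omega> (Suc (Suc n)) < c"
    using order_tendstoD(2)[OF ratio c(1)] by (auto simp: eventually_sequentially)
  have "summable (\<lambda>n. 1 / \<omega> (Suc n))"
  proof (rule summable_ratio_test[OF c(2)])
    show "norm (1 / \<omega> (Suc (Suc n))) \<le> c * norm (1 / \<omega> (Suc n))" if "n \<ge> N" for n
      using N[OF that] pos[of n] pos[of "Suc n"] by (simp add: field_simps)
  qed
  then have "(\<lambda>n. 1 / \<omega> (Suc n)) \<longlonglongrightarrow> 0" by (rule summable_LIMSEQ_zero)
  then have "(\<lambda>n. 1 / \<omega> (Suc (Suc n))) \<longlonglongrightarrow> 0" by (rule LIMSEQ_Suc)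
  from tendsto_mult_right_zero[OF tendsto_real_sqrt[OF this, simplified], of "\<bar>a\<bar>"]
  have A: "(\<lambda>n. \<bar>a\<bar> * sqrt (1 / \<omega> (Suc (Suc n)))) \<longlonglongrightarrow> 0" by (simp add: real_sqrt_divide)
  have B: "(\<lambda>n. sqrt (\<omega> (Suc n) / \<omega> (Suc (Suc n)))) \<longlonglongrightarrow> sqrt r"
    by (intro tendsto_real_sqrt ratio)
  define s where "s n = \<bar>poly (jacobi_poly \<omega> n) a\<bar> / sqrt (jacobi_norm \<omega> n)" for n
  have h: "jacobi_norm \<omega> n > 0" for n using \<omega> by (rule jacobi_norm_pos)
  have "summable (\<lambda>n. (s n)\<^sup>2)"
  proof (rule summable_square_of_recurrence[OF _ _ _ _ A B])
    show "s n \<ge> 0" for n using h[of n] by (simp add: s_def)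
    show "\<bar>a\<bar> * sqrt (1 / \<omega> (Suc (Suc n))) \<ge> 0" for n using pos[of "Suc n"] by simp
    show "sqrt (\<omega> (Suc n) / \<omega> (Suc (Suc n))) \<ge> 0" for n using pos[of n] pos[of "Suc n"] by simp
    show "sqrt r < 1" using \<open>r < 1\<close> by simp
    show "s (Suc (Suc n)) \<le> \<bar>a\<bar> * sqrt (1 / \<omega> (Suc (Suc n))) * s (Suc n)
        + sqrt (\<omega> (Suc n) / \<omega> (Suc (Suc n))) * s n" for n
    proof -
      let ?P = "\<lambda>n. poly (jacobi_poly \<omega> n) a" and ?h = "\<lambda>n. sqrt (jacobi_norm \<omega> n)"
      let ?u = "sqrt (\<omega> (Suc n))" and ?v = "sqrt (\<omega> (Suc (Suc n)))"
      have "\<bar>?P (Suc (Suc n))\<bar> = \<bar>a * ?P (Suc n) - \<omega> (Suc n) * ?P n\<bar>" by simp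
      also have "\<dots> \<le> \<bar>a\<bar> * \<bar>?P (Suc n)\<bar> + \<omega> (Suc n) * \<bar>?P n\<bar>"
        using abs_triangle_ineq4[of "a * ?P (Suc n)" "\<omega> (Suc n) * ?P n"] pos[of n]
        by (simp add: abs_mult)
      finally have "s (Suc (Suc n)) \<le> (\<bar>a\<bar> * \<bar>?P (Suc n)\<bar> + \<omega> (Suc n) * \<bar>?P n\<bar>) / ?h (Suc (Suc n))"
        unfolding s_def using h[of "Suc (Suc n)"] by (intro divide_right_mono) auto
      also have "\<dots> = \<bar>a\<bar> * \<bar>?P (Suc n)\<bar> / ?h (Suc (Suc n)) + \<omega> (Suc n) * \<bar>?P n\<bar> / ?h (Suc (Suc n))"
        by (rule add_divide_distrib)
      also have "\<bar>a\<bar> * \<bar>?P (Suc n)\<bar> / ?h (Suc (Suc n)) = \<bar>a\<bar> * sqrt (1 / \<omega> (Suc (Suc n))) * s (Suc n)"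
        by (simp add: s_def jacobi_norm_Suc[of \<omega> "Suc n"] real_sqrt_mult real_sqrt_divide)
      also have "\<omega> (Suc n) * \<bar>?P n\<bar> / ?h (Suc (Suc n)) = sqrt (\<omega> (Suc n) / \<omega> (Suc (Suc n))) * s n"
      proof -
        have "?h (Suc (Suc n)) = ?v * (?u * ?h n)" by (simp add: jacobi_norm_Suc real_sqrt_mult)
        moreover have "u * u * x / (v * (u * h)) = u / v * (x / h)" if "u \<noteq> 0" for u v x h :: real
          using that by simp
        from this[of ?u] have "?u * ?u * x / (?v * (?u * h)) = ?u / ?v * (x / h)" for x h
          using pos[of n] by simp
        moreover have "?u * ?u = \<omega> (Suc n)" using pos[of n] by simp
        ultimately show ?thesis by (simp only: s_def real_sqrt_divide)
      qed
      finally show ?thesis .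
    qed
  qed
  moreover have "(s n)\<^sup>2 = (poly (jacobi_poly \<omega> n) a)\<^sup>2 / jacobi_norm \<omega> n" for n
    using h[of n] by (simp add: s_def power_divide)
  ultimately show "summable (\<lambda>k. (poly (jacobi_poly \<omega> k) a)\<^sup>2 / jacobi_norm \<omega> k)" by simp
qed

section \<open>Determinacy for at most linear growth\<close>

text \<open>
  The path weights are monotone in \<open>\<omega>\<close>, and the right-hand side is their value for \<open>\<omega> j = j\<close>, the Jacobi
  sequence of the standard normal distribution.
\<close>
lemma dyck_weight_bound:
  assumes nonneg: "\<forall>n\<ge>1. \<omega> n \<ge> 0" and le: "\<forall>n\<ge>1. \<omega> n \<le> real n"
  shows "dyck_weight \<omega> n k \<ge> 0"
    and "n = k + 2 * l \<Longrightarrow> dyck_weight \<omega> n k \<le> fact n / (fact k * 2 ^ l * fact l)"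
proof -
  show nn: "dyck_weight \<omega> n k \<ge> 0" for n k
  proof (induction n arbitrary: k)
    case (Suc n)
    have "\<omega> (Suc k) \<ge> 0" using nonneg by simp
    then show ?case using Suc by simp
  qed simp
  show "dyck_weight \<omega> n k \<le> fact n / (fact k * 2 ^ l * fact l)" if "n = k + 2 * l" for l
    using that
  proof (induction n arbitrary: k l)
    case (Suc n)
    define B where "B = fact n / (fact k * 2 ^ l * fact l :: real)"
    have first: "(if k = 0 then 0 else dyck_weight \<omega> n (k - 1)) \<le> real k * B"
    proof (cases k)
      case (Suc k')
      have "dyck_weight \<omega> n k' \<le> fact n / (fact k' * 2 ^ l * fact l)"
        using Suc.prems Suc by (intro Suc.IH) simp
      also have "\<dots> = real k * B" by (simp add: B_def Suc del: of_nat_Suc)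
      finally show ?thesis using Suc by simp
    qed simp
    have second: "\<omega> (Suc k) * dyck_weight \<omega> n (Suc k) \<le> real (2 * l) * B"
    proof (cases l)
      case 0
      then have "dyck_weight \<omega> n (Suc k) = 0" using Suc.prems by (intro dyck_weight_eq_0) simp
      then show ?thesis using 0 by simp
    next
      case (Suc l')
      have "\<omega> (Suc k) * dyck_weight \<omega> n (Suc k)
          \<le> real (Suc k) * (fact n / (fact (Suc k) * 2 ^ l' * fact l'))"
        using Suc.prems Suc le nn nonneg by (intro mult_mono Suc.IH) auto
      also have "\<dots> = real (2 * l) * B" by (simp add: B_def Suc field_simps del: of_nat_Suc) simp
      finally show ?thesis .
    qed
    have "dyck_weight \<omega> (Suc n) k \<le> (real k + real (2 * l)) * B"
      using first second by (simp add: distrib_right)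
    also have "real k + real (2 * l) = real (Suc n)" using Suc.prems by simp
    finally show ?case by (simp add: B_def)
  qed simp
qed

text \<open>
  The moments of the standard normal distribution grow so slowly that the Taylor remainder of the
  characteristic function tends to zero at every point. Hence the moments determine the characteristic
  function, which determines the measure.
\<close>
lemma moment_determinacy:
  assumes M: "real_distribution M" "\<And>n. integrable M (\<lambda>x. x ^ n)" "\<And>n. (\<integral>x. x ^ n \<partial>M) = m n"
    and N: "real_distribution N" "\<And>n. integrable N (\<lambda>x. x ^ n)" "\<And>n. (\<integral>x. x ^ n \<partial>N) = m n"
    and growth: "\<And>l. m (2 * l) \<le> fact (2 * l) / (2 ^ l * fact l)"
  shows "M = N"
proof -
  have "char K t = lim (\<lambda>l. \<Sum>k\<le>2 * l. (\<i> * t) ^ k / fact k * m k)"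
    if K: "real_distribution K" "\<And>n. integrable K (\<lambda>x. x ^ n)" "\<And>n. (\<integral>x. x ^ n \<partial>K) = m n" for K t
  proof -
    let ?S = "\<lambda>l. \<Sum>k\<le>2 * l. (\<i> * t) ^ k / fact k * m k"
    interpret real_distribution K by (rule K)
    have err: "cmod (char K t - ?S l) \<le> 2 * ((t\<^sup>2 / 2) ^ l / fact l)" for l
    proof -
      have "cmod (char K t - ?S l) \<le> (2 * \<bar>t\<bar> ^ (2 * l) / fact (2 * l)) * (\<integral>x. \<bar>x\<bar> ^ (2 * l) \<partial>K)"
        using char_approx1[of "2 * l" t] K by simp
      also have "(\<integral>x. \<bar>x\<bar> ^ (2 * l) \<partial>K) = m (2 * l)" using K(3) by (simp add: power_even_abs)
      also have "2 * \<bar>t\<bar> ^ (2 * l) / fact (2 * l) * m (2 * l)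
          \<le> 2 * \<bar>t\<bar> ^ (2 * l) / fact (2 * l) * (fact (2 * l) / (2 ^ l * fact l))"
        by (intro mult_left_mono growth) auto
      also have "\<dots> = 2 * ((t\<^sup>2 / 2) ^ l / fact l)"
        by (simp add: power_mult power_divide)
      finally show ?thesis .
    qed
    have "(\<lambda>l. (t\<^sup>2 / 2) ^ l / fact l) \<longlonglongrightarrow> 0"
      using summable_LIMSEQ_zero[OF summable_exp[of "t\<^sup>2 / 2"]]
      by (simp only: divide_inverse mult.commute)
    then have "(\<lambda>l. 2 * ((t\<^sup>2 / 2) ^ l / fact l)) \<longlonglongrightarrow> 0"
      by (rule tendsto_mult_right_zero)
    with always_eventually[OF allI[OF err]] have "(\<lambda>l. char K t - ?S l) \<longlonglongrightarrow> 0"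
      by (rule Lim_null_comparison)
    then have "(\<lambda>l. ?S l - char K t) \<longlonglongrightarrow> 0"
      using tendsto_minus by fastforce
    then have "?S \<longlonglongrightarrow> char K t"
      by (rule LIM_zero_cancel)
    then show ?thesis by (simp add: limI)
  qed
  from this[OF M] this[OF N] have "char M = char N" by (intro ext) simp
  then show ?thesis by (rule Levy_uniqueness[OF M(1) N(1)])
qed

lemma not_indeterminate_of_linear_bound:
  assumes nonneg: "\<forall>n\<ge>1. \<omega> n \<ge> 0" and le: "\<forall>n\<ge>1. \<omega> n \<le> real n"
  shows "\<not> indeterminate \<omega>"
proof -
  have "dyck_weight \<omega> (2 * l) 0 \<le> fact (2 * l) / (2 ^ l * fact l)" for l
    using dyck_weight_bound(2)[OF nonneg le, of "2 * l" 0 l] by simp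
  then have "\<mu> = \<nu>" if "realizes_jacobi \<mu> \<omega>" "realizes_jacobi \<nu> \<omega>" for \<mu> \<nu>
    by (intro moment_determinacy[OF moments_of_realizes_jacobi[OF that(1)]
          moments_of_realizes_jacobi[OF that(2)]])
  then show ?thesis unfolding indeterminate_def by blast
qed

section \<open>The q-Gaussian\<close>

text \<open>
  Both branches of the definition take one form in terms of \<open>\<bar>q\<bar>\<close> and the sign of \<open>q\<close>, which allows positivity
  and growth to be treated together.
\<close>
lemma q_gaussian_jacobi_abs_gt_1:
  assumes "\<bar>q\<bar> > 1" and "n \<ge> 1"
  shows "q_gaussian_jacobi q n = (\<bar>q\<bar> ^ n - sgn q ^ n) / (\<bar>q\<bar> - sgn q)"
proof (cases "q > 0")
  case True
  then show ?thesis using assms by (simp add: q_gaussian_jacobi_def geometric_sum)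
next
  case False
  define p where "p = - q"
  have p: "p > 1" "q = - p" using assms False by (auto simp: p_def)
  obtain k where "n = Suc k" using assms(2) by (cases n) auto
  have sq: "(- 1) ^ k * (- 1) ^ k = (1::real)" by (simp flip: power_mult_distrib)
  have "(- p) ^ k = (- 1) ^ k * p ^ k" by (simp flip: power_mult_distrib)
  then have "(- 1) ^ k * ((- p) ^ Suc k - 1) = - (p ^ Suc k - (- 1) ^ Suc k)"
    using sq by (simp add: algebra_simps)
  then have "q_gaussian_jacobi q n = - (p ^ n - (- 1) ^ n) / (- p - 1)"
    using p \<open>n = Suc k\<close> by (simp only: q_gaussian_jacobi_def times_divide_eq_right) simp
  also have "\<dots> = (p ^ n - (- 1) ^ n) / (p + 1)"
    using minus_divide_divide[of "p ^ n - (- 1) ^ n" "p + 1"] by simp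
  finally show ?thesis using p by simp
qed

lemma q_gaussian_jacobi_pos:
  assumes "\<bar>q\<bar> > 1" and "n \<ge> 1"
  shows "q_gaussian_jacobi q n > 0"
proof -
  have "sgn q ^ n \<le> \<bar>sgn q\<bar> ^ n" by (metis abs_ge_self power_abs)
  also have "\<dots> \<le> 1" by (rule power_le_one) (auto simp: sgn_if)
  also have "1 < \<bar>q\<bar> ^ n" using assms by (simp add: one_less_power)
  finally have "\<bar>q\<bar> ^ n - sgn q ^ n > 0" by simp
  moreover have "\<bar>q\<bar> - sgn q > 0" using assms(1) by (auto simp: sgn_if)
  ultimately show ?thesis by (simp add: q_gaussian_jacobi_abs_gt_1[OF assms])
qed

lemma q_gaussian_jacobi_ratio:
  assumes "\<bar>q\<bar> > 1"
  shows "(\<lambda>n. q_gaussian_jacobi q (Suc n) / q_gaussian_jacobi q (Suc (Suc n))) \<longlonglongrightarrow> 1 / \<bar>q\<bar>"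
proof -
  let ?p = "\<bar>q\<bar>" and ?e = "sgn q"
  define d where "d = ?e / ?p"
  have "\<bar>d\<bar> < 1" using assms by (auto simp: d_def abs_sgn_eq)
  then have d: "(\<lambda>n. d ^ n) \<longlonglongrightarrow> 0" by (rule LIMSEQ_abs_realpow_zero2)
  have den: "?p - ?e \<noteq> 0" using assms by (auto simp: sgn_if)
  have "(\<lambda>n. (1 - d ^ n) / (?p - ?e * d ^ n)) \<longlonglongrightarrow> (1 - 0) / (?p - ?e * 0)"
    using assms by (intro tendsto_intros d) auto
  then have "(\<lambda>n. (1 - d ^ Suc n) / (?p - ?e * d ^ Suc n)) \<longlonglongrightarrow> 1 / ?p"
    by (intro LIMSEQ_Suc) simp
  moreover have "q_gaussian_jacobi q (Suc n) / q_gaussian_jacobi q (Suc (Suc n))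
      = (1 - d ^ Suc n) / (?p - ?e * d ^ Suc n)" for n
  proof -
    have "?p ^ Suc n \<noteq> 0" using assms by simp
    have "?e ^ Suc n = ?p ^ Suc n * d ^ Suc n" using assms by (simp add: d_def power_divide)
    then have "?p ^ Suc n - ?e ^ Suc n = ?p ^ Suc n * (1 - d ^ Suc n)"
      "?p ^ Suc (Suc n) - ?e ^ Suc (Suc n) = ?p ^ Suc n * (?p - ?e * d ^ Suc n)"
      unfolding power_Suc[of _ "Suc n"] right_diff_distrib by (simp_all only: mult_1_right ac_simps)
    then show ?thesis
      using den \<open>?p ^ Suc n \<noteq> 0\<close> by (simp add: q_gaussian_jacobi_abs_gt_1[OF assms] del: power_Suc)
  qed
  ultimately show ?thesis by simp
qed

lemma q_gaussian_jacobi_linear_bound: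
  assumes "\<bar>q\<bar> \<le> 1" "q \<noteq> - 1"
  shows "0 \<le> q_gaussian_jacobi q n" and "q_gaussian_jacobi q n \<le> real n"
proof -
  have eq: "q_gaussian_jacobi q n = (\<Sum>k<n. q ^ k)" using assms by (simp add: q_gaussian_jacobi_def)
  have le: "q ^ k \<le> 1" for k
    using power_le_one[of "\<bar>q\<bar>" k] assms(1) by (simp add: abs_le_iff flip: power_abs)
  show "q_gaussian_jacobi q n \<le> real n"
    unfolding eq using sum_bounded_above[of "{..<n}" "\<lambda>k. q ^ k" 1] le by simp
  show "0 \<le> q_gaussian_jacobi q n"
  proof (cases "q = 1")
    case False
    then show ?thesis
      unfolding eq geometric_sum[OF False] using le[of n] assms by (intro divide_nonpos_nonpos) auto
  next
    case True
    then show ?thesis unfolding eq by simp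
  qed
qed

theorem theorem1p1:
  fixes q :: real
  assumes "q \<noteq> -1"
  shows "indeterminate (q_gaussian_jacobi q) \<longleftrightarrow> \<bar>q\<bar> > 1"
proof
  assume "\<bar>q\<bar> > 1"
  then show "indeterminate (q_gaussian_jacobi q)"
    using q_gaussian_jacobi_pos q_gaussian_jacobi_ratio
    by (intro indeterminate_of_geometric_growth[where r = "1 / \<bar>q\<bar>"]) auto
next
  assume "indeterminate (q_gaussian_jacobi q)"
  then show "\<bar>q\<bar> > 1"
    using not_indeterminate_of_linear_bound q_gaussian_jacobi_linear_bound assms
    by (meson not_le)
qed

end
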